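(* Assume the Extended Riemann Hypothesis (ERH). Let $g>1$ be an integer, and let $f(X)\in\mathbb{Z}[X]$ be a polynomial of degree $\deg f\ge 3$ with a positive leading coefficient and no multiple roots in its splitting field. Put $u(n)=f(g^n)$ for $n\ge 1$. Let $\alpha>0$ be a real number for which $$ \left|\left\{\ell\le z:\ \ell \text{ is prime and } P^+(\ell-1)\ge \ell^{\alpha}\right\}\right|\gg \frac{z}{\log z} $$ for all sufficiently large $z$, where the implied constant depends only on $\alpha$. Then for $M\in\mathbb{Z}$, integers $N\ge1$ and $S\ge 1$, $$ \mathcal{Q}_u(M,N;S)\le S^{1/2}N^{1/(1+\alpha)+o(1)} $$ as $N\to\infty$, where the function of $N$ implied by $o(1)$ depends only on $f$, $g$ and $\alpha$.
   Context: ERH: all zeros in the critical strip $0<\operatorname{Re} s<1$ of the Dedekind zeta functions of number fields (hence also of all Dirichlet $L$-functions) lie on the line $\operatorname{Re} s=1/2$. $P^+(k)$ denotes the largest prime divisor of an integer $k\ge 2$. For $M,N,s\in\mathbb{Z}$ with $N\ge1$ and $s$ squarefree, $Q_u(M,N;s)$ denotes the number of integers $n\in[M+1,M+N]$ (with $n\ge 1$, where $u(n)$ is defined) for which $\mathbb{Q}(\sqrt{u(n)})=\mathbb{Q}(\sqrt{s})$. Put $$\mathcal{Q}_u(M,N;S)=\sum_{\substack{1\le s\le S\\ s\text{ squarefree}}}Q_u(M,N;s).$$ The notation $B\gg A$ means $|A|\le cB$ for some constant $c>0$ (the implied constant). *)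

theory Defs
  imports
    "HOL-Complex_Analysis.Complex_Analysis"
    "HOL-Computational_Algebra.Computational_Algebra"
    "HOL-Algebra.Embedded_Algebras"
    "HOL-Algebra.Generated_Fields"
    "HOL-Algebra.QuotRing"
    "HOL-Algebra.Algebraic_Closure_Type"
begin

abbreviation complex_ring :: "complex ring" where
  "complex_ring \<equiv> ring_of_type_algebra"

(* Every number field embeds into the complex numbers, and its Dedekind zeta function depends
   only on its isomorphism class, so number fields are taken inside the complex numbers. *)
definition number_field :: "complex set \<Rightarrow> bool" where
  "number_field K \<longleftrightarrow> subfield K complex_ring \<and> ring.finite_dimension complex_ring \<rat> K"

definition ring_of_integers :: "complex set \<Rightarrow> complex ring" where
  "ring_of_integers K = complex_ring \<lparr>carrier := {x \<in> K. algebraic_int x}\<rparr>"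

definition ideal_norm :: "complex set \<Rightarrow> complex set \<Rightarrow> nat" where
  "ideal_norm K I = card (carrier (ring_of_integers K Quot I))"

definition dedekind_series :: "complex set \<Rightarrow> complex \<Rightarrow> complex" where
  "dedekind_series K s =
     (\<Sum>\<^sub>\<infinity>I\<in>{I. ideal I (ring_of_integers K) \<and> I \<noteq> {0}}. of_nat (ideal_norm K I) powr (- s))"

(* The analytic continuation of the series from the half-plane Re s > 1 to the plane without
   the point 1.  By the identity theorem the choice is unique off 1; the value at 1 is
   irrelevant. *)
definition dedekind_zeta :: "complex set \<Rightarrow> complex \<Rightarrow> complex" where
  "dedekind_zeta K =
     (SOME F. F holomorphic_on (- {1}) \<and> (\<forall>s. Re s > 1 \<longrightarrow> F s = dedekind_series K s))"

definition extended_riemann_hypothesis :: bool where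
  "extended_riemann_hypothesis \<longleftrightarrow>
     (\<forall>K s. number_field K \<and> 0 < Re s \<and> Re s < 1 \<and> dedekind_zeta K s = 0 \<longrightarrow> Re s = 1 / 2)"

(* The value 1 for k < 2 is a convention. *)
definition largest_prime_divisor :: "nat \<Rightarrow> nat" where
  "largest_prime_divisor k = (if k \<ge> 2 then Max (prime_factors k) else 1)"

(* The field Q(sqrt d) inside the complex numbers; it equals Q when d is a square, including
   d = 0. *)
definition quadratic_field :: "int \<Rightarrow> complex set" where
  "quadratic_field d = generate_field complex_ring (\<rat> \<union> {csqrt (of_int d)})"

definition Q_count :: "(nat \<Rightarrow> int) \<Rightarrow> int \<Rightarrow> nat \<Rightarrow> int \<Rightarrow> nat" where
  "Q_count u M N s =
     card {n::nat. n \<ge> 1 \<and> int n \<in> {M + 1..M + int N} \<and> quadratic_field (u n) = quadratic_field s}"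

definition Q_sum :: "(nat \<Rightarrow> int) \<Rightarrow> int \<Rightarrow> nat \<Rightarrow> int \<Rightarrow> nat" where
  "Q_sum u M N S = (\<Sum>s | s \<in> {1..S} \<and> squarefree s. Q_count u M N s)"

end

theory Submission
  imports Defs "HOL-Real_Asymp.Real_Asymp"
begin

text \<open>
  For a fixed squarefree s only O(log N) exponents n in an interval of length N satisfy
  f(g^n) = s y^2, uniformly in s and in the position of the interval. Hence the sum is at most
  both N and S O(log N), so at most the geometric mean S^(1/2) N^(1/2 + o(1)); and
  1/2 < 1/(1 + alpha), because P^+(l - 1) < l forces alpha < 1.

  For the bound at a fixed s put x = g^n and suppose f(0) is nonzero. The integer x is large at
  the infinite place but small at every prime q dividing g, where y is plus or minus
  sqrt(f(0)/s) times a power series in x. Once the signs are fixed, divided differences of y at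
  K + 1 points whose exponents have ratio close to 1 are q-adically integral up to a bounded
  factor. As they are also tiny in absolute value they vanish, so y is a polynomial in x of
  degree less than K. Since f is squarefree, s y^2 = f(x) is then possible for boundedly many x
  only. The exponents of an interval of length N fall into O(log N) such blocks.
\<close>

section \<open>Divided differences\<close>

text \<open>For nonempty \<open>A\<close> this is the top coefficient of the polynomial
  interpolating \<open>h\<close> on \<open>A\<close>. The Lagrange form is symmetric in the nodes,
  so they can be given as a set.\<close>

definition divided_difference :: "int set \<Rightarrow> (int \<Rightarrow> complex) \<Rightarrow> complex" where
  "divided_difference A h = (\<Sum>x\<in>A. h x / of_int (\<Prod>y\<in>A - {x}. x - y))"

lemma divided_difference_add:
  "divided_difference A (\<lambda>x. h x + k x) = divided_difference A h + divided_difference A k"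
  by (simp add: divided_difference_def add_divide_distrib sum.distrib)

lemma divided_difference_diff:
  "divided_difference A (\<lambda>x. h x - k x) = divided_difference A h - divided_difference A k"
  by (simp add: divided_difference_def diff_divide_distrib sum_subtractf)

lemma divided_difference_cmult:
  "divided_difference A (\<lambda>x. a * h x) = a * divided_difference A h"
  by (simp add: divided_difference_def sum_distrib_left)

text \<open>The factor \<open>x - a\<close> kills the term at \<open>a\<close> and cancels in the
  other denominators. This replaces the usual recursion over ordered nodes.\<close>

lemma divided_difference_remove:
  assumes "finite A" "a \<in> A"
  shows "divided_difference A (\<lambda>x. of_int (x - a) * h x) = divided_difference (A - {a}) h"
proof -
  have "divided_difference A (\<lambda>x. of_int (x - a) * h x) =
      (\<Sum>x\<in>A - {a}. of_int (x - a) * h x / of_int (\<Prod>y\<in>A - {x}. x - y))"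
    unfolding divided_difference_def using assms by (subst sum.remove[of A a]) auto
  also have "\<dots> = divided_difference (A - {a}) h"
    unfolding divided_difference_def
  proof (rule sum.cong[OF refl])
    fix x assume x: "x \<in> A - {a}"
    have "(\<Prod>y\<in>A - {x}. x - y) = (x - a) * (\<Prod>y\<in>A - {x} - {a}. x - y)"
      using assms x by (subst prod.remove[of _ a]) auto
    also have "A - {x} - {a} = A - {a} - {x}" by auto
    finally have eq: "(\<Prod>y\<in>A - {x}. x - y) = (x - a) * (\<Prod>y\<in>A - {a} - {x}. x - y)" .
    have "of_int (x - a) \<noteq> (0 :: complex)" using x by (subst of_int_eq_0_iff) auto
    then show "of_int (x - a) * h x / of_int (\<Prod>y\<in>A - {x}. x - y) =
        h x / of_int (\<Prod>y\<in>A - {a} - {x}. x - y)"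
      unfolding eq of_int_mult by (subst mult_divide_mult_cancel_left) auto
  qed
  finally show ?thesis .
qed

text \<open>Write \<open>x = a + (x - a)\<close>. This Leibniz rule supports induction along
  Horner's scheme.\<close>

lemma divided_difference_mult_ident:
  assumes "finite A" "a \<in> A"
  shows "divided_difference A (\<lambda>x. of_int x * h x) =
    of_int a * divided_difference A h + divided_difference (A - {a}) h"
proof -
  have "divided_difference A (\<lambda>x. of_int x * h x) =
      divided_difference A (\<lambda>x. of_int a * h x + of_int (x - a) * h x)"
    by (rule arg_cong[where f = "divided_difference A"]) (auto simp: algebra_simps)
  then show ?thesis
    by (simp only: divided_difference_add divided_difference_cmult
        divided_difference_remove[OF assms])
qed

lemma divided_difference_singleton [simp]: "divided_difference {x} h = h x"
  by (simp add: divided_difference_def)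

text \<open>Node removal applied to the constant \<open>(x - a) - (x - b)\<close> expresses the
  divided difference, times \<open>b - a\<close>, as a difference of two over smaller sets. These
  agree: both are 1 for two nodes, and otherwise both are 0 by induction.\<close>

lemma divided_difference_one:
  assumes "card A \<ge> 2"
  shows "divided_difference A (\<lambda>_. 1) = 0"
  using assms
proof (induction "card A" arbitrary: A rule: less_induct)
  case less
  have fin: "finite A" using less.prems card.infinite by fastforce
  obtain a b where ab: "a \<in> A" "b \<in> A" "a \<noteq> b"
    using less.prems by (metis card_le_Suc0_iff_eq fin not_less_eq_eq numeral_2_eq_2)
  have eq: "divided_difference (A - {a}) (\<lambda>_. 1) = divided_difference (A - {b}) (\<lambda>_. 1)"
  proof (cases "card A = 2")
    case True
    then have "A = {a, b}" using ab fin by (metis card_2_iff doubleton_eq_iff empty_iff insert_iff)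
    then have "A - {a} = {b}" "A - {b} = {a}" using ab by auto
    then show ?thesis by simp
  next
    case False
    then have "card (A - {a}) \<ge> 2" "card (A - {b}) \<ge> 2"
      "card (A - {a}) < card A" "card (A - {b}) < card A"
      using less.prems ab fin by (auto simp: card_gt_0_iff)
    then show ?thesis using less.hyps by simp
  qed
  have "of_int (b - a) * divided_difference A (\<lambda>_. 1) =
      divided_difference A (\<lambda>x. of_int (x - a) * 1 - of_int (x - b) * 1)"
    by (subst divided_difference_cmult[symmetric], rule arg_cong[where f = "divided_difference A"]) auto
  also have "\<dots> = 0"
    by (simp only: divided_difference_diff divided_difference_remove[OF fin ab(1)]
        divided_difference_remove[OF fin ab(2)] eq diff_self)
  finally show ?case using ab by (metis (no_types) mult_eq_0_iff of_int_eq_0_iff eq_iff_diff_eq_0)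
qed

text \<open>Horner's scheme and the Leibniz rule. Integrality is what later turns a congruence
  between \<open>Y\<close> and a multiple of \<open>poly P\<close> into divisibility of a
  numerator.\<close>

lemma divided_difference_int_poly:
  assumes "finite A"
  shows "divided_difference A (\<lambda>x. of_int (poly p x)) \<in> \<int>"
  using assms
proof (induction p arbitrary: A)
  case 0
  then show ?case by (simp add: divided_difference_def)
next
  case (pCons c p)
  have one: "divided_difference A (\<lambda>_. 1) \<in> \<int>"
  proof (cases "card A \<ge> 2")
    case True
    then show ?thesis by (simp add: divided_difference_one)
  next
    case False
    then consider "A = {}" | x where "A = {x}"
      using pCons.prems by (metis One_nat_def card_0_eq card_1_singletonE less_2_cases not_less)
    then show ?thesis by cases (auto simp: divided_difference_def)
  qed
  show ?case
  proof (cases "A = {}")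
    case True
    then show ?thesis by (simp add: divided_difference_def)
  next
    case False
    then obtain a where a: "a \<in> A" by auto
    have "divided_difference A (\<lambda>x. of_int (poly (pCons c p) x)) =
        divided_difference A (\<lambda>x. of_int c * 1 + of_int x * of_int (poly p x))"
      by simp
    also have "\<dots> = of_int c * divided_difference A (\<lambda>_. 1) +
        (of_int a * divided_difference A (\<lambda>x. of_int (poly p x)) +
         divided_difference (A - {a}) (\<lambda>x. of_int (poly p x)))"
      by (simp only: divided_difference_add divided_difference_cmult
          divided_difference_mult_ident[OF pCons.prems a])
    also have "\<dots> \<in> \<int>" using one pCons by (intro Ints_add Ints_mult) auto
    finally show ?thesis .
  qed
qed

text \<open>The same induction: passing from \<open>pCons c p\<close> to \<open>p\<close> lowers the
  degree by one, which pays for the node lost in \<open>A - {a}\<close>.\<close>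

lemma divided_difference_poly_eq_0:
  assumes "Polynomial.degree p + 2 \<le> card A"
  shows "divided_difference A (\<lambda>x. poly p (of_int x)) = 0"
  using assms
proof (induction p arbitrary: A)
  case 0
  then show ?case by (simp add: divided_difference_def)
next
  case (pCons c p)
  then have fin: "finite A" using card.infinite by fastforce
  obtain a where a: "a \<in> A" using pCons.prems by fastforce
  have one: "divided_difference A (\<lambda>_. 1) = 0"
    using pCons.prems by (intro divided_difference_one) auto
  have IH: "divided_difference A (\<lambda>x. poly p (of_int x)) = 0"
    "divided_difference (A - {a}) (\<lambda>x. poly p (of_int x)) = 0"
  proof -
    show "divided_difference A (\<lambda>x. poly p (of_int x)) = 0"
      using pCons.prems by (intro pCons.IH) (auto split: if_splits)
    show "divided_difference (A - {a}) (\<lambda>x. poly p (of_int x)) = 0"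
    \<comment> \<open>A constant \<open>pCons c 0\<close> has the same degree as \<open>0\<close>,
      so here nothing pays for the lost node.\<close>
    proof (cases "p = 0")
      case True
      then show ?thesis by (simp add: divided_difference_def)
    next
      case False
      then show ?thesis using pCons.prems a fin by (intro pCons.IH) auto
    qed
  qed
  have "divided_difference A (\<lambda>x. poly (pCons c p) (of_int x)) =
      divided_difference A (\<lambda>x. c * 1 + of_int x * poly p (of_int x))"
    by simp
  also have "\<dots> = c * divided_difference A (\<lambda>_. 1) +
      (of_int a * divided_difference A (\<lambda>x. poly p (of_int x)) +
       divided_difference (A - {a}) (\<lambda>x. poly p (of_int x)))"
    by (simp only: divided_difference_add divided_difference_cmult
        divided_difference_mult_ident[OF fin a])
  finally show ?case using one IH by simp
qed

section \<open>Polynomial interpolation\<close>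

text \<open>Newton's form: a multiple of the polynomial vanishing at the old nodes corrects the
  value at the new one.\<close>

lemma interpolation_exists:
  fixes h :: "'a::field \<Rightarrow> 'a"
  assumes "finite B"
  shows "\<exists>R. Polynomial.degree R \<le> card B - 1 \<and> (\<forall>b\<in>B. poly R b = h b)"
  using assms
proof (induction B)
  case empty
  show ?case by (rule exI[of _ 0]) auto
next
  case (insert b B)
  then obtain R where R: "Polynomial.degree R \<le> card B - 1" "\<forall>b\<in>B. poly R b = h b" by auto
  define P where "P = (\<Prod>c\<in>B. [:- c, 1:])"
  have degP: "Polynomial.degree P \<le> card B"
    unfolding P_def using degree_prod_sum_le[OF insert.hyps(1), of "\<lambda>c. [:- c, 1:]"] by simp
  have zero: "poly P c = 0" if "c \<in> B" for c
    using that insert.hyps by (auto simp: P_def poly_prod)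
  have nz: "poly P b \<noteq> 0" using insert.hyps by (auto simp: P_def poly_prod)
  define R' where "R' = R + Polynomial.smult ((h b - poly R b) / poly P b) P"
  have "Polynomial.degree R' \<le> card B"
    unfolding R'_def using R(1) degP
    by (intro degree_add_le) (auto intro: order_trans[OF degree_smult_le])
  moreover have "\<forall>c\<in>insert b B. poly R' c = h c"
    using R(2) zero nz by (auto simp: R'_def)
  ultimately show ?case using insert.hyps by (intro exI[of _ R']) auto
qed

text \<open>Any \<open>K\<close> of the points determine \<open>R\<close>. At a further point
  \<open>x\<close>, the divided difference of \<open>h - R\<close> over \<open>insert x B\<close>
  has only the term at \<open>x\<close>, so its vanishing gives \<open>h x = R x\<close>.\<close>

lemma interpolation_if_divided_differences_vanish:
  assumes "finite Z" "K \<ge> 1" "K \<le> card Z"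
    and vanish: "\<And>A. A \<subseteq> Z \<Longrightarrow> card A = K + 1 \<Longrightarrow> divided_difference A h = 0"
  shows "\<exists>R. Polynomial.degree R \<le> K - 1 \<and> (\<forall>x\<in>Z. poly R (of_int x) = h x)"
proof -
  obtain B where B: "B \<subseteq> Z" "card B = K" using assms(3) by (meson obtain_subset_with_card_n)
  have finB: "finite B" using B assms finite_subset by blast
  have inj: "inj_on (of_int :: int \<Rightarrow> complex) B" by (auto simp: inj_on_def)
  have "\<exists>R. Polynomial.degree R \<le> card ((of_int :: int \<Rightarrow> complex) ` B) - 1 \<and>
      (\<forall>b\<in>of_int ` B. poly R b = (h \<circ> the_inv_into B of_int) b)"
    using finB by (intro interpolation_exists) auto
  then obtain R where R: "Polynomial.degree R \<le> K - 1"
    "\<And>b. b \<in> B \<Longrightarrow> poly R (of_int b) = h b"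
    using B by (auto simp: card_image[OF inj] the_inv_into_f_f[OF inj])
  have "poly R (of_int x) = h x" if x: "x \<in> Z" for x
  proof (cases "x \<in> B")
    case True
    then show ?thesis using R by auto
  next
    case False
    let ?A = "insert x B"
    have card: "card ?A = K + 1" using False B finB by simp
    have "divided_difference ?A (\<lambda>z. h z - poly R (of_int z)) = 0"
      unfolding divided_difference_diff
      using vanish[of ?A] divided_difference_poly_eq_0[of R ?A] R card x B assms(2) by auto
    moreover have "divided_difference ?A (\<lambda>z. h z - poly R (of_int z)) =
        (h x - poly R (of_int x)) / of_int (\<Prod>y\<in>?A - {x}. x - y)"
    proof -
      have "(\<Sum>z\<in>B. (h z - poly R (of_int z)) / of_int (\<Prod>y\<in>?A - {z}. z - y)) = 0"
        using R by (intro sum.neutral) auto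
      then show ?thesis unfolding divided_difference_def using False finB
        by (subst sum.insert) auto
    qed
    moreover have "(\<Prod>y\<in>?A - {x}. x - y) \<noteq> 0" using finB by auto
    ultimately show ?thesis by (metis divide_eq_0_iff of_int_eq_0_iff eq_iff_diff_eq_0)
  qed
  then show ?thesis using R by blast
qed

section \<open>Local signs of square values\<close>

text \<open>Only the \<open>q\<close>-adic valuation of a factor matters. The value
  \<open>w' = 0\<close> is listed apart because \<open>multiplicity q 0\<close> is 0 by
  convention.\<close>

lemma prime_power_dvd_transfer:
  fixes q :: int
  assumes q: "Factorial_Ring.prime q" and w: "w \<noteq> 0"
    and le: "w' = 0 \<or> multiplicity q w \<le> multiplicity q w'"
    and dvd: "q ^ T dvd w * v"
  shows "q ^ T dvd w' * v"
proof (cases "w' = 0 \<or> v = 0")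
  case False
  have "\<not> is_unit q" using q not_prime_unit by blast
  then have "T \<le> multiplicity q (w * v)"
    using dvd w False power_dvd_iff_le_multiplicity[of "w * v" q] by simp
  also have "\<dots> = multiplicity q w + multiplicity q v"
    using w False prime_elem_multiplicity_mult_distrib[OF prime_imp_prime_elem[OF q]] by simp
  also have "\<dots> \<le> multiplicity q (w' * v)"
    using le False prime_elem_multiplicity_mult_distrib[OF prime_imp_prime_elem[OF q]] by simp
  finally show ?thesis by (rule multiplicity_dvd')
qed auto

text \<open>Each power of \<open>q\<close> up to the \<open>n\<close>-th divides both numbers or
  neither; higher powers divide neither.\<close>

lemma multiplicity_eq_if_cong:
  fixes q :: int
  assumes "q ^ n dvd w - w'" "\<not> q ^ n dvd w'"
  shows "multiplicity q w = multiplicity q w'"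
proof -
  have iff: "q ^ r dvd w \<longleftrightarrow> q ^ r dvd w'" for r
  proof (cases "r \<le> n")
    case True
    then have "q ^ r dvd w - w'" using assms(1) power_le_dvd by blast
    then show ?thesis by (metis dvd_diff_commute dvd_diffD dvd_diffD1 diff_add_cancel dvd_add_right_iff)
  next
    case False
    then have "\<not> q ^ r dvd w'" using assms(2) by (meson nat_le_linear power_le_dvd)
    moreover have "\<not> q ^ n dvd w" using assms by (metis dvd_diff_commute diff_add_cancel dvd_add_right_iff)
    then have "\<not> q ^ r dvd w" using False by (meson nat_le_linear power_le_dvd)
    ultimately show ?thesis by simp
  qed
  then show ?thesis by (simp add: multiplicity_def)
qed

lemma not_dvd_if_small:
  fixes q c :: int
  assumes "q \<ge> 2" "c \<noteq> 0" "nat \<bar>c\<bar> \<le> n"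
  shows "\<not> q ^ n dvd c"
proof
  assume "q ^ n dvd c"
  then have "\<bar>q ^ n\<bar> \<le> \<bar>c\<bar>" using assms(2) dvd_imp_le_int by blast
  moreover have "int n < 2 ^ n" using of_nat_less_two_power by blast
  moreover have "(2::int) ^ n \<le> q ^ n" using assms(1) by (intro power_mono) auto
  ultimately show False using assms by linarith
qed

lemma dvd_if_prime_powers_dvd:
  fixes g v :: int
  assumes g: "g > 0"
    and q: "\<And>q. Factorial_Ring.prime q \<Longrightarrow> q dvd g \<Longrightarrow> q ^ (n * multiplicity q g) dvd v"
  shows "g ^ n dvd v"
proof (cases "v = 0")
  case False
  show ?thesis
  proof (rule multiplicity_le_imp_dvd)
    show "g ^ n \<noteq> 0" using g by simp
    fix q :: int assume q': "Factorial_Ring.prime q"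
    show "multiplicity q (g ^ n) \<le> multiplicity q v"
    proof (cases "q dvd g")
      case True
      have "\<not> is_unit q" using q' not_prime_unit by blast
      then have "n * multiplicity q g \<le> multiplicity q v"
        using q[OF q' True] \<open>v \<noteq> 0\<close> power_dvd_iff_le_multiplicity[of v q] by simp
      then show ?thesis using g prime_elem_multiplicity_power_distrib[OF prime_imp_prime_elem[OF q']] by simp
    next
      case False
      then have "\<not> q dvd g ^ n" using q' prime_dvd_power by blast
      then show ?thesis by (simp add: not_dvd_imp_multiplicity_0)
    qed
  qed
qed auto

text \<open>The factors \<open>e * (u - v)\<close> and \<open>e * (u + v)\<close> add up to
  \<open>2 * e * u\<close>, so the lower of the two powers of \<open>q\<close> found in them divides
  \<open>2 * e * u\<close>. Trading one factor for \<open>2 * e * u\<close> leaves all of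
  \<open>q ^ T\<close> with a single sign.\<close>

lemma prime_power_dvd_square_diff:
  fixes q :: int
  assumes q: "Factorial_Ring.prime q" and dvd: "q ^ T dvd e * (u\<^sup>2 - v\<^sup>2)"
  shows "q ^ T dvd 2 * e\<^sup>2 * u * (u - v) \<or> q ^ T dvd 2 * e\<^sup>2 * u * (u + v)"
proof -
  have "q ^ T dvd (e * (u - v)) * (e * (u + v))"
    using dvd_mult[OF dvd, of e] by (simp add: power2_eq_square algebra_simps)
  then obtain A B where AB: "q ^ T = A * B" "A dvd e * (u - v)" "B dvd e * (u + v)"
    using division_decomp by blast
  have "A dvd q ^ T" "B dvd q ^ T" using AB(1) by auto
  \<comment> \<open>Divisors of a prime power are prime powers up to a unit.\<close>
  then obtain i j where ij: "A dvd q ^ i" "q ^ i dvd A" "B dvd q ^ j" "q ^ j dvd B"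
    using q by (metis divides_primepow_weak dvd_normalize_iff dvd_refl normalize_dvd_iff)
  have dv: "q ^ T dvd q ^ i * q ^ j" unfolding AB(1) using ij by (intro mult_dvd_mono)
  have sum: "e * (u - v) + e * (u + v) = 2 * e * u" by (simp add: algebra_simps)
  have i: "q ^ i dvd e * (u - v)" and j: "q ^ j dvd e * (u + v)" using AB ij dvd_trans by blast+
  show ?thesis
  proof (cases "i \<le> j")
    case True
    then have "q ^ i dvd e * (u + v)" using j power_le_dvd by blast
    then have "q ^ i dvd 2 * e * u" using i sum by (metis dvd_add)
    then have "q ^ i * q ^ j dvd (2 * e * u) * (e * (u + v))" using j by (rule mult_dvd_mono)
    then have "q ^ T dvd (2 * e * u) * (e * (u + v))"
      using dv dvd_trans by blast
    then have "q ^ T dvd 2 * e\<^sup>2 * u * (u + v)"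
      by (simp only: power2_eq_square mult_ac)
    then show ?thesis ..
  next
    case False
    then have "q ^ j dvd e * (u - v)" using i power_le_dvd by (metis nat_le_linear)
    then have "q ^ j dvd 2 * e * u" using j sum by (metis dvd_add)
    then have "q ^ i * q ^ j dvd (e * (u - v)) * (2 * e * u)" using i by (intro mult_dvd_mono)
    then have "q ^ T dvd (e * (u - v)) * (2 * e * u)"
      using dv dvd_trans by blast
    then have "q ^ T dvd 2 * e\<^sup>2 * u * (u - v)"
      by (simp only: power2_eq_square mult_ac)
    then show ?thesis ..
  qed
qed

text \<open>With the denominators cleared, P / G is a truncation of the power series of sqrt(F / c).\<close>

lemma square_root_approximation:
  fixes F :: "int poly"
  assumes c: "poly F 0 = c" "c \<noteq> 0"
  shows "\<exists>(P :: int poly) (G :: int) (R :: int poly). G \<noteq> 0 \<and> poly P 0 = G \<and>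
    (\<forall>x. c * (poly P x)\<^sup>2 = G\<^sup>2 * poly F x + x ^ Suc J * poly R x)"
proof (induction J)
  case 0
  obtain a F' where F: "F = pCons a F'" by (cases F) auto
  have "a = c" using c F by simp
  then have "\<forall>x. c * (poly 1 x)\<^sup>2 = 1\<^sup>2 * poly F x + x ^ Suc 0 * poly (- F') x"
    using F by simp
  then show ?case using poly_1 zero_neq_one by metis
next
  case (Suc J)
  then obtain P G R where IH: "G \<noteq> 0" "poly P 0 = G"
    "\<And>x. c * (poly P x)\<^sup>2 = G\<^sup>2 * poly F x + x ^ Suc J * poly R x" by blast
  obtain r R' where R: "R = pCons r R'" by (cases R) auto
  obtain a P' where "P = pCons a P'" by (cases P) auto
  then have P: "P = pCons G P'" using IH(2) by simp
  \<comment> \<open>A Newton step without division: after scaling \<open>P\<close> by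
    \<open>t\<close>, the error coefficient at \<open>x ^ Suc J\<close> is
    \<open>t\<^sup>2 * r\<close>. Subtracting \<open>r * x ^ Suc J\<close> contributes
    \<open>- 2 * c * t * r * G\<close>, and this \<open>t\<close> makes the two cancel.\<close>
  define t where "t = 2 * c * G"
  define P2 where "P2 = Polynomial.smult t P + Polynomial.monom (- r) (Suc J)"
  define R2 where "R2 = Polynomial.smult (t\<^sup>2) R' - Polynomial.smult (2 * c * t * r) P' +
    Polynomial.monom (c * r\<^sup>2) J"
  have "c * (poly P2 x)\<^sup>2 = (t * G)\<^sup>2 * poly F x + x ^ Suc (Suc J) * poly R2 x" for x
  proof -
    have "c * (poly P2 x)\<^sup>2 = t\<^sup>2 * (c * (poly P x)\<^sup>2) - 2 * c * t * r * x ^ Suc J * poly P x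
        + c * r\<^sup>2 * (x ^ Suc J)\<^sup>2"
      by (simp add: P2_def poly_monom power2_eq_square algebra_simps)
    also have "\<dots> = t\<^sup>2 * (G\<^sup>2 * poly F x + x ^ Suc J * (r + x * poly R' x))
        - 2 * c * t * r * x ^ Suc J * (G + x * poly P' x) + c * r\<^sup>2 * (x ^ Suc J)\<^sup>2"
      unfolding IH(3) by (simp add: R P)
    also have "\<dots> = (t * G)\<^sup>2 * poly F x + x ^ Suc (Suc J) * poly R2 x"
      by (simp add: R2_def poly_monom t_def power2_eq_square algebra_simps)
    finally show ?thesis .
  qed
  moreover have "t * G \<noteq> 0" using IH(1) c by (simp add: t_def)
  moreover have "poly P2 0 = t * G" using IH(2) by (simp add: P2_def poly_monom)
  ultimately show ?case by blast
qed

lemma ident_dvd_poly_diff: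
  fixes p :: "int poly"
  shows "x dvd poly p x - poly p 0"
  by (cases p) auto

text \<open>The value is congruent to \<open>poly p 0\<close> modulo \<open>q ^ n\<close>, and
  \<open>n\<close> is so large that \<open>q ^ n\<close> does not divide
  \<open>poly p 0\<close>.\<close>

lemma poly_at_power_multiplicity:
  fixes g q :: int and p :: "int poly"
  assumes g: "g > 1" and q: "Factorial_Ring.prime q" "q dvd g"
    and p: "poly p 0 \<noteq> 0" "nat \<bar>poly p 0\<bar> \<le> n"
  shows "multiplicity q (poly p (g ^ n)) = multiplicity q (poly p 0)"
    and "poly p (g ^ n) \<noteq> 0"
proof -
  have nd: "\<not> q ^ n dvd poly p 0"
    using q p by (intro not_dvd_if_small) (auto simp: prime_ge_2_int)
  have d: "q ^ n dvd poly p (g ^ n) - poly p 0"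
    using q(2) ident_dvd_poly_diff[of "g ^ n" p] dvd_power_same dvd_trans by blast
  show "multiplicity q (poly p (g ^ n)) = multiplicity q (poly p 0)"
    using d nd by (rule multiplicity_eq_if_cong)
  show "poly p (g ^ n) \<noteq> 0" using d nd by (metis diff_0 dvd_minus_iff)
qed

text \<open>
  Modulo high powers of q, the quotients of y and z by the values of P have the same square. Hence
  they agree up to sign, where the constant D absorbs the loss of q-divisibility.
\<close>

lemma square_points_sign:
  fixes g q s y z c G :: int and F P R :: "int poly"
  assumes g: "g > 1" and q: "Factorial_Ring.prime q" "q dvd g"
    and c: "poly F 0 = c" "c \<noteq> 0" and G: "poly P 0 = G" "G \<noteq> 0"
    and approx: "\<And>x. c * (poly P x)\<^sup>2 = G\<^sup>2 * poly F x + x ^ L * poly R x"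
    and s: "squarefree s" "s > 0"
    and n: "N \<le> n" "N \<le> m" "nat \<bar>c\<bar> \<le> N" "nat \<bar>G\<bar> \<le> N"
    and y: "poly F (g ^ n) = s * y\<^sup>2" and z: "poly F (g ^ m) = s * z\<^sup>2"
  defines "D \<equiv> 2 * c ^ 3 * G ^ 5 * g"
    and "T \<equiv> N * L * multiplicity q g"
  shows "q ^ T dvd D * (poly P (g ^ m) * y - poly P (g ^ n) * z) \<or>
         q ^ T dvd D * (poly P (g ^ m) * y + poly P (g ^ n) * z)"
proof -
  let ?pn = "poly P (g ^ n)" and ?pm = "poly P (g ^ m)"
  have "q ^ T = (q ^ multiplicity q g) ^ (N * L)"
    unfolding T_def by (metis mult.commute power_mult)
  also have "\<dots> dvd g ^ (N * L)" by (intro dvd_power_same multiplicity_dvd)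
  finally have qT: "q ^ T dvd g ^ (N * L)" .
  have dvd: "q ^ T dvd c * (poly P (g ^ k))\<^sup>2 - G\<^sup>2 * poly F (g ^ k)" if "N \<le> k" for k
  proof -
    have "g ^ (N * L) dvd (g ^ k) ^ L" using that
      by (auto simp flip: power_mult intro!: le_imp_power_dvd)
    then show ?thesis using qT approx[of "g ^ k"] by (auto intro: dvd_trans)
  qed
  \<comment> \<open>The congruences between \<open>c * P\<^sup>2\<close> and
    \<open>G\<^sup>2 * F\<close> at the two points are combined so that the terms free of
    \<open>s\<close> cancel.\<close>
  have "c * G\<^sup>2 * s * ((?pm * y)\<^sup>2 - (?pn * z)\<^sup>2) =
      c * ?pn\<^sup>2 * (c * ?pm\<^sup>2 - G\<^sup>2 * (s * z\<^sup>2)) - c * ?pm\<^sup>2 * (c * ?pn\<^sup>2 - G\<^sup>2 * (s * y\<^sup>2))"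
    by (simp add: power2_eq_square algebra_simps)
  then have "q ^ T dvd c * G\<^sup>2 * s * ((?pm * y)\<^sup>2 - (?pn * z)\<^sup>2)"
    using dvd[OF n(1)] dvd[OF n(2)] unfolding y z by (metis dvd_diff dvd_mult)
  note cases = prime_power_dvd_square_diff[OF q(1) this]
  \<comment> \<open>The cofactor left by the choice of sign is traded for a constant. Multiplying by
    \<open>y\<close> produces \<open>s * y\<^sup>2 = poly F (g ^ n)\<close>, which has the valuation
    of \<open>c\<close>; \<open>?pm\<close> has that of \<open>G\<close>. The remaining
    \<open>s\<close> is squarefree, so it contributes at most one \<open>q\<close>, paid for by the
    factor \<open>g\<close> of \<open>D\<close>. Hence \<open>D\<close> does not depend on
    \<open>s\<close>.\<close>
  have clean: "q ^ T dvd D * w" if "q ^ T dvd 2 * (c * G\<^sup>2 * s)\<^sup>2 * (?pm * y) * w" for w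
  proof -
    have ms: "multiplicity q s \<le> multiplicity q g"
    proof -
      have "multiplicity q s \<le> 1"
        using s q(1) squarefree_factorial_semiring''[of s] by auto
      moreover have "multiplicity q g \<ge> 1"
      proof -
        have "\<not> is_unit q" using q(1) not_prime_unit by blast
        then show ?thesis using q(2) g power_dvd_iff_le_multiplicity[of g q 1] by auto
      qed
      ultimately show ?thesis by simp
    qed
    have nz: "poly F (g ^ n) \<noteq> 0" "?pm \<noteq> 0"
      and mult: "multiplicity q (poly F (g ^ n)) = multiplicity q c" "multiplicity q ?pm = multiplicity q G"
      using poly_at_power_multiplicity[OF g q, of F n] poly_at_power_multiplicity[OF g q, of P m] c G n
      by auto
    have "q ^ T dvd poly F (g ^ n) * (2 * c\<^sup>2 * G ^ 4 * s * ?pm * w)"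
      using dvd_mult[OF that, of y] unfolding y
      by (simp add: power2_eq_square power4_eq_xxxx mult_ac)
    then have "q ^ T dvd c * (2 * c\<^sup>2 * G ^ 4 * s * ?pm * w)"
      by (rule prime_power_dvd_transfer[OF q(1) nz(1), rotated]) (simp add: mult)
    then have "q ^ T dvd ?pm * (2 * c ^ 3 * G ^ 4 * s * w)"
      by (simp add: power2_eq_square power3_eq_cube mult_ac)
    then have "q ^ T dvd G * (2 * c ^ 3 * G ^ 4 * s * w)"
      by (rule prime_power_dvd_transfer[OF q(1) nz(2), rotated]) (simp add: mult)
    then have "q ^ T dvd s * (2 * c ^ 3 * G ^ 5 * w)"
      by (simp add: eval_nat_numeral mult_ac)
    then have "q ^ T dvd g * (2 * c ^ 3 * G ^ 5 * w)"
      by (rule prime_power_dvd_transfer[OF q(1), of s, rotated 2]) (use s ms in auto)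
    then show ?thesis by (simp add: D_def mult_ac)
  qed
  show ?thesis using cases clean by blast
qed

section \<open>Divisibility against size\<close>

text \<open>The common denominator \<open>U\<close> is a product of \<open>K * (K + 1)\<close>
  differences divisible by \<open>g ^ N\<close>. Since \<open>p * Y\<close> is, up to
  \<open>D\<close>, congruent to a multiple of \<open>poly P\<close>, whose divided difference is an
  integer, the numerator \<open>E\<close> inherits this divisibility up to \<open>D * G\<close>. By
  \<open>size\<close> it is too small to be nonzero. The multiplier \<open>e\<close> may vary with
  \<open>q\<close>, so divisibility is shown one prime at a time.\<close>

lemma divided_difference_vanishes:
  fixes A :: "int set" and Y :: "int \<Rightarrow> int" and g m p z D G B :: int and P :: "int poly"
  assumes g: "g > 1" and A: "card A = K + 1"
    and pts: "\<And>x. x \<in> A \<Longrightarrow> g ^ N dvd x \<and> 0 < x \<and> x \<le> m"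
    and p: "p \<noteq> 0" "\<And>q. Factorial_Ring.prime q \<Longrightarrow> q dvd g \<Longrightarrow> multiplicity q p = multiplicity q G"
    and D: "D \<noteq> 0" "G \<noteq> 0"
    and cong: "\<And>q. Factorial_Ring.prime q \<Longrightarrow> q dvd g \<Longrightarrow>
      \<exists>e. \<forall>x\<in>A. q ^ (N * (K * (K + 1)) * multiplicity q g) dvd D * (p * Y x - e * poly P x * z)"
    and Y: "\<And>x. x \<in> A \<Longrightarrow> \<bar>Y x\<bar> \<le> B * m ^ d"
    and size: "\<bar>D * G\<bar> * (int K + 1) * B * m ^ (d + K * K) < g ^ (N * (K * (K + 1)))"
  shows "divided_difference A (\<lambda>x. of_int (Y x)) = 0"
proof -
  have fin: "finite A" using A card.infinite by fastforce
  define W where "W x = (\<Prod>y\<in>A - {x}. x - y)" for x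
  define V where "V x = (\<Prod>t\<in>A - {x}. W t)" for x
  define U where "U = (\<Prod>x\<in>A. W x)"
  have W: "W x \<noteq> 0" for x using fin by (auto simp: W_def)
  have U_V: "U = W x * V x" if "x \<in> A" for x
    unfolding U_def V_def using fin that by (subst prod.remove[of A x]) auto
  have dd: "of_int (\<Sum>x\<in>A. h x * V x) = of_int U * divided_difference A (\<lambda>x. of_int (h x))"
    for h :: "int \<Rightarrow> int"
    unfolding divided_difference_def sum_distrib_left of_int_sum
  proof (rule sum.cong[OF refl])
    fix x assume "x \<in> A"
    then show "of_int (h x * V x) = of_int U * (of_int (h x) / of_int (\<Prod>y\<in>A - {x}. x - y) :: complex)"
      using W[of x] unfolding U_V[OF \<open>x \<in> A\<close>] W_def[symmetric] by simp
  qed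
  have cardA: "card (A - {x}) = K" if "x \<in> A" for x using that A fin by simp
  have U_dvd: "g ^ (N * (K * (K + 1))) dvd U"
  proof -
    have "(g ^ N) ^ K dvd W x" if "x \<in> A" for x
    proof -
      have "(\<Prod>y\<in>A - {x}. g ^ N) dvd W x"
        unfolding W_def using pts that by (intro prod_dvd_prod) auto
      then show ?thesis using cardA[OF that] by simp
    qed
    then have "(\<Prod>x\<in>A. (g ^ N) ^ K) dvd U" unfolding U_def by (intro prod_dvd_prod)
    then have "((g ^ N) ^ K) ^ (K + 1) dvd U" using A by simp
    then show ?thesis by (simp only: power_mult[symmetric] mult.assoc)
  qed
  \<comment> \<open>the divided difference of \<open>Y\<close>, multiplied by the common denominator \<open>U\<close>\<close>
  define E where "E = (\<Sum>x\<in>A. Y x * V x)"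
  have "g ^ (N * (K * (K + 1))) dvd D * G * E"
  proof (rule dvd_if_prime_powers_dvd)
    fix q :: int assume q: "Factorial_Ring.prime q" "q dvd g"
    let ?T = "N * (K * (K + 1)) * multiplicity q g"
    obtain e where e: "\<And>x. x \<in> A \<Longrightarrow> q ^ ?T dvd D * (p * Y x - e * poly P x * z)"
      using cong[OF q] by blast
    obtain k where k: "divided_difference A (\<lambda>x. of_int (poly P x)) = of_int k"
      using divided_difference_int_poly[OF fin, of P] by (auto elim: Ints_cases)
    have "(\<Sum>x\<in>A. poly P x * V x) = U * k"
      using dd[of "poly P"] unfolding k of_int_mult[symmetric] of_int_eq_iff by simp
    moreover have "q ^ ?T = (q ^ multiplicity q g) ^ (N * (K * (K + 1)))"
      by (metis mult.commute power_mult)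
    then have "q ^ ?T dvd g ^ (N * (K * (K + 1)))"
      by (metis dvd_power_same multiplicity_dvd)
    then have "q ^ ?T dvd U" using U_dvd dvd_trans by blast
    ultimately have "q ^ ?T dvd D * e * z * (\<Sum>x\<in>A. poly P x * V x)" by simp
    moreover have "q ^ ?T dvd (\<Sum>x\<in>A. D * (p * Y x - e * poly P x * z) * V x)"
      using e by (intro dvd_sum) auto
    moreover have "(\<Sum>x\<in>A. D * (p * Y x - e * poly P x * z) * V x) =
        p * (D * E) - D * e * z * (\<Sum>x\<in>A. poly P x * V x)"
      by (simp add: E_def sum_distrib_left sum_subtractf algebra_simps)
    ultimately have "q ^ ?T dvd p * (D * E)" by (metis diff_add_cancel dvd_add)
    then have "q ^ ?T dvd G * (D * E)"
      by (rule prime_power_dvd_transfer[OF q(1), of p, rotated 2]) (use p q in auto)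
    then show "q ^ ?T dvd D * G * E" by (simp add: mult_ac)
  qed (use g in auto)
  moreover have "\<bar>D * G * E\<bar> < g ^ (N * (K * (K + 1)))"
  proof -
    obtain a where "a \<in> A" using A by fastforce
    then have m: "m > 0" using pts[of a] by linarith
    have Wle: "\<bar>W x\<bar> \<le> m ^ K" if "x \<in> A" for x
    proof -
      have "\<bar>W x\<bar> \<le> (\<Prod>y\<in>A - {x}. m)"
        unfolding W_def abs_prod
      proof (intro prod_mono conjI)
        fix y assume "y \<in> A - {x}"
        then show "\<bar>x - y\<bar> \<le> m" using pts[of x] pts[of y] that by (simp add: abs_le_iff)
      qed simp
      then show ?thesis using cardA[OF that] by simp
    qed
    have Vle: "\<bar>V x\<bar> \<le> m ^ (K * K)" if "x \<in> A" for x
    proof -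
      have "\<bar>V x\<bar> \<le> (\<Prod>t\<in>A - {x}. m ^ K)"
        unfolding V_def abs_prod using Wle by (intro prod_mono) auto
      then show ?thesis using cardA[OF that] by (simp add: power_mult)
    qed
    have "\<bar>E\<bar> \<le> (\<Sum>x\<in>A. \<bar>Y x * V x\<bar>)" unfolding E_def by (rule sum_abs)
    also have "\<dots> \<le> (\<Sum>x\<in>A. (B * m ^ d) * m ^ (K * K))"
      unfolding abs_mult
    proof (rule sum_mono)
      fix x assume x: "x \<in> A"
      show "\<bar>Y x\<bar> * \<bar>V x\<bar> \<le> B * m ^ d * m ^ (K * K)"
        using Y[OF x] Vle[OF x] by (intro mult_mono) linarith+
    qed
    also have "\<dots> = (int K + 1) * B * m ^ (d + K * K)"
      using A by (simp add: power_add)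
    finally have "\<bar>D * G\<bar> * \<bar>E\<bar> \<le> \<bar>D * G\<bar> * ((int K + 1) * B * m ^ (d + K * K))"
      by (intro mult_left_mono) auto
    also have "\<dots> < g ^ (N * (K * (K + 1)))" using size by (simp only: mult.assoc)
    finally show ?thesis by (simp only: abs_mult)
  qed
  moreover have "\<bar>g ^ (N * (K * (K + 1)))\<bar> = g ^ (N * (K * (K + 1)))" using g by simp
  ultimately have "D * G * E = 0" by (metis dvd_imp_le_int not_le)
  then have "E = 0" using D by simp
  then have "of_int U * divided_difference A (\<lambda>x. of_int (Y x)) = 0"
    using dd[of Y] by (simp add: E_def)
  moreover have "U \<noteq> 0" using W fin by (simp add: U_def)
  ultimately show ?thesis by simp
qed

section \<open>Square values in a block of exponents\<close>

text \<open>The nonconstant \<open>Q\<close> has a root; it would be a root of \<open>R\<close>,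
  hence also of the derivative of \<open>Q\<close>.\<close>

lemma rsquarefree_ne_smult_square:
  fixes Q R :: "complex poly"
  assumes "rsquarefree Q" "Polynomial.degree Q \<ge> 1"
  shows "Polynomial.smult a (R\<^sup>2) \<noteq> Q"
proof
  assume eq: "Polynomial.smult a (R\<^sup>2) = Q"
  have "\<not> constant (poly Q)" using assms(2) by (simp add: constant_degree)
  then obtain z where z: "poly Q z = 0" using fundamental_theorem_of_algebra by blast
  have "a \<noteq> 0" using eq assms(2) by auto
  then have "poly R z = 0" using z by (simp add: eq[symmetric] power2_eq_square)
  then have "poly (pderiv Q) z = 0"
    by (simp add: eq[symmetric] power2_eq_square pderiv_smult pderiv_mult)
  then show False using assms(1) z rsquarefree_roots by blast
qed

lemma abs_poly_le_power:
  fixes F :: "int poly"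
  assumes "x \<ge> 1"
  shows "\<bar>poly F x\<bar> \<le> (\<Sum>i\<le>Polynomial.degree F. \<bar>Polynomial.coeff F i\<bar>) * x ^ Polynomial.degree F"
proof -
  have "\<bar>poly F x\<bar> \<le> (\<Sum>i\<le>Polynomial.degree F. \<bar>Polynomial.coeff F i * x ^ i\<bar>)"
    unfolding poly_altdef by (rule sum_abs)
  also have "\<dots> \<le> (\<Sum>i\<le>Polynomial.degree F. \<bar>Polynomial.coeff F i\<bar> * x ^ Polynomial.degree F)"
    using assms by (intro sum_mono) (auto simp: abs_mult intro!: mult_left_mono power_increasing)
  finally show ?thesis by (simp add: sum_distrib_right)
qed

lemma poly_map_poly_of_int:
  "poly (map_poly of_int p) (of_int x :: 'a::comm_ring_1) = of_int (poly p x)"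
  by (induction p) (auto simp: map_poly_pCons)

lemma card_le_fibres:
  assumes "finite A" "finite I" "f ` A \<subseteq> I" "\<And>i. i \<in> I \<Longrightarrow> card {a \<in> A. f a = i} \<le> b"
  shows "card A \<le> card I * b"
proof -
  have "A = (\<Union>i\<in>I. {a \<in> A. f a = i})" using assms(3) by auto
  then have "card A \<le> (\<Sum>i\<in>I. card {a \<in> A. f a = i})"
    using card_UN_le[OF assms(2), of "\<lambda>i. {a \<in> A. f a = i}"] by simp
  also have "\<dots> \<le> card I * b" using assms(4) sum_bounded_above[of I "\<lambda>i. card {a \<in> A. f a = i}" b] by simp
  finally show ?thesis .
qed

text \<open>The points are roots of \<open>s\<close> times the square of \<open>R\<close> minus
  \<open>F\<close>, which is nonzero because \<open>F\<close> is squarefree.\<close>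

lemma interpolated_square_points_bound:
  fixes F :: "int poly" and A :: "int set" and Y :: "int \<Rightarrow> int" and R :: "complex poly"
  assumes F: "rsquarefree (map_poly of_int F :: complex poly)" "Polynomial.degree F \<ge> 1"
    and R: "Polynomial.degree R \<le> Polynomial.degree F" "\<And>x. x \<in> A \<Longrightarrow> poly R (of_int x) = of_int (Y x)"
    and Y: "\<And>x. x \<in> A \<Longrightarrow> poly F x = s * (Y x)\<^sup>2"
  shows "card A \<le> 2 * Polynomial.degree F"
proof -
  let ?F = "map_poly of_int F :: complex poly"
  define Q where "Q = Polynomial.smult (of_int s) (R\<^sup>2) - ?F"
  have deg: "Polynomial.degree ?F = Polynomial.degree F" by (simp add: degree_map_poly)
  have "Q \<noteq> 0" unfolding Q_def
    using rsquarefree_ne_smult_square[OF F(1), of "of_int s" R] F(2) deg by simp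
  moreover have "Polynomial.degree Q \<le> 2 * Polynomial.degree F"
  proof -
    have "Polynomial.degree (R\<^sup>2) \<le> 2 * Polynomial.degree F"
      using R(1) degree_mult_le[of R R] by (simp add: power2_eq_square)
    then show ?thesis unfolding Q_def using deg degree_smult_le[of "of_int s" "R\<^sup>2"]
      by (intro degree_diff_le) auto
  qed
  moreover have "of_int ` A \<subseteq> {z. poly Q z = 0}"
    using R(2) Y by (auto simp: Q_def poly_map_poly_of_int)
  moreover have "card ((of_int :: int \<Rightarrow> complex) ` A) = card A" by (intro card_image) (auto simp: inj_on_def)
  ultimately show ?thesis
    by (metis card_mono order_trans card_poly_roots_bound poly_roots_finite)
qed

text \<open>If \<open>n / N \<le> 1 + 1 / (2 * L)\<close>, then
  \<open>n * (L - 1) \<le> N * (L - 1 / 2)\<close>. The slack of \<open>N / 2\<close> will absorb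
  multiplicative constants.\<close>

lemma block_exponent_le:
  fixes N n L :: nat
  assumes "L \<ge> 1" "2 * L * n \<le> (2 * L + 1) * N"
  shows "n * (L - 1) + N div 2 \<le> N * L"
proof -
  have "2 * L * (n * (L - 1)) + L * N \<le> (2 * L + 1) * N * (L - 1) + L * N"
    using mult_le_mono1[OF assms(2), of "L - 1"] by (simp add: mult_ac)
  also have "\<dots> \<le> 2 * L * (N * L)"
    using assms(1) by (cases L) (auto simp: algebra_simps)
  finally have "2 * L * (n * (L - 1)) + 2 * L * (N div 2) \<le> 2 * L * (N * L)"
    by (smt (verit) add_left_mono div_times_less_eq_dividend mult.commute mult.left_commute mult_le_mono2 order_trans)
  then have "2 * L * (n * (L - 1) + N div 2) \<le> 2 * L * (N * L)" by (simp add: distrib_left)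
  then show ?thesis using assms(1) by simp
qed

text \<open>Sort the points by their signs relative to a fixed one. In a class with more than
  \<open>K\<close> points the divided differences over \<open>K + 1\<close> points vanish, so the
  square roots are values of one polynomial, which bounds the class. That \<open>N0\<close>,
  \<open>b\<close> and \<open>L\<close> are fixed before \<open>s\<close> and \<open>N\<close> gives
  the uniformity.\<close>

lemma square_points_in_block_bounded:
  fixes F :: "int poly" and g :: int
  assumes g: "g > 1" and F: "rsquarefree (map_poly of_int F :: complex poly)"
    "Polynomial.degree F \<ge> 1" "poly F 0 \<noteq> 0"
  shows "\<exists>N0 b L. L \<ge> 1 \<and> (\<forall>s N Z. squarefree s \<longrightarrow> s > 0 \<longrightarrow> N0 \<le> N \<longrightarrow> finite Z \<longrightarrow>
    (\<forall>n\<in>Z. N \<le> n \<and> 2 * L * n \<le> (2 * L + 1) * N \<and> (\<exists>y. poly F (g ^ n) = s * y\<^sup>2)) \<longrightarrow>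
    card Z \<le> b)"
proof -
  define d where "d = Polynomial.degree F"
  \<comment> \<open>The numerator of a divided difference is at most a constant times
    \<open>m ^ (d + K * K)\<close> and is compared with \<open>g ^ (N * L)\<close>. This
    \<open>K\<close> makes \<open>d + K * K\<close> equal to \<open>L - 1\<close>.\<close>
  define K where "K = d + 1"
  define L where "L = K * (K + 1)"
  define c where "c = poly F 0"
  have K: "K \<ge> 1" and L: "L \<ge> 1" by (auto simp: K_def L_def)
  obtain P :: "int poly" and G and R :: "int poly" where G: "poly P 0 = G" "G \<noteq> 0"
    and approx: "\<And>x. c * (poly P x)\<^sup>2 = G\<^sup>2 * poly F x + x ^ L * poly R x"
    using square_root_approximation[of F c "L - 1"] F(3) L by (auto simp: c_def)
  define D where "D = 2 * c ^ 3 * G ^ 5 * g"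
  define B where "B = (\<Sum>i\<le>d. \<bar>Polynomial.coeff F i\<bar>)"
  define H where "H = \<bar>D * G\<bar> * (int K + 1) * B"
  have D: "D \<noteq> 0" using F(3) G g by (simp add: D_def c_def)
  have "B \<ge> 0" by (simp add: B_def sum_nonneg)
  then have H0: "H \<ge> 0" by (simp add: H_def)
  \<comment> \<open>The first two summands make the valuations at \<open>g ^ n\<close> those of
    \<open>c\<close> and \<open>G\<close>; the third gives \<open>H < g ^ (N div 2)\<close>.\<close>
  define N0 where "N0 = nat \<bar>c\<bar> + nat \<bar>G\<bar> + 2 * nat H + 2"
  \<comment> \<open>A factor 2 for the sign at each prime divisor of \<open>g\<close>, and at most
    \<open>2 * K\<close> points per sign pattern.\<close>
  define b where "b = 2 ^ card (prime_factors g) * (2 * K)"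
  have "card Z \<le> b" if s: "squarefree s" "s > 0" and N: "N0 \<le> N" and Z: "finite Z"
    and block: "\<And>n. n \<in> Z \<Longrightarrow> N \<le> n \<and> 2 * L * n \<le> (2 * L + 1) * N \<and> (\<exists>y. poly F (g ^ n) = s * y\<^sup>2)"
    for s :: int and N and Z :: "nat set"
  proof (cases "Z = {}")
    case False
    define A where "A = (\<lambda>n. g ^ n) ` Z"
    have inj: "inj_on (\<lambda>n. g ^ n) Z" using g by (auto simp: inj_on_def)
    have finA: "finite A" using Z by (simp add: A_def)
    have cardA: "card A = card Z" unfolding A_def by (rule card_image[OF inj])
    define M where "M = Max Z"
    have M: "M \<in> Z" "\<And>n. n \<in> Z \<Longrightarrow> n \<le> M" using False Z by (auto simp: M_def)
    define m where "m = g ^ M"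
    have "\<forall>x\<in>A. \<exists>y. poly F x = s * y\<^sup>2" using block by (auto simp: A_def)
    then obtain Y where Y: "\<And>x. x \<in> A \<Longrightarrow> poly F x = s * (Y x)\<^sup>2" by metis
    have pts: "g ^ N dvd x \<and> 0 < x \<and> x \<le> m" if "x \<in> A" for x
      using that g M block unfolding A_def m_def
      by (auto intro!: le_imp_power_dvd power_increasing)
    have Yle: "\<bar>Y x\<bar> \<le> B * m ^ d" if x: "x \<in> A" for x
    proof -
      \<comment> \<open>Wasteful, but it yields a bound independent of \<open>s\<close>.\<close>
      have "\<bar>Y x\<bar> \<le> (Y x)\<^sup>2"
        using self_le_power[of "\<bar>Y x\<bar>" 2] by (cases "Y x = 0") auto
      also have "\<dots> \<le> s * (Y x)\<^sup>2" using s by (simp add: mult_le_cancel_right1)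
      also have "\<dots> \<le> B * x ^ d"
        using abs_poly_le_power[of x F] pts[OF x] Y[OF x] by (simp add: B_def d_def)
      also have "\<dots> \<le> B * m ^ d"
        using \<open>B \<ge> 0\<close> pts[OF x] by (intro mult_left_mono power_mono) auto
      finally show ?thesis .
    qed
    have size: "\<bar>D * G\<bar> * (int K + 1) * B * m ^ (d + K * K) < g ^ (N * (K * (K + 1)))"
    proof -
      have "nat H < 2 ^ (N div 2)"
      proof -
        have "nat H \<le> N div 2" using N by (simp add: N0_def)
        also have "\<dots> < 2 ^ (N div 2)" by simp
        finally show ?thesis .
      qed
      then have "int (nat H) < int (2 ^ (N div 2))" by (simp only: of_nat_less_iff)
      then have "H < 2 ^ (N div 2)" using H0 by simp
      also have "(2 :: int) ^ (N div 2) \<le> g ^ (N div 2)" using g by (intro power_mono) auto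
      finally have H: "H < g ^ (N div 2)" .
      have "d + K * K = L - 1" by (simp add: L_def K_def)
      then have "H * m ^ (d + K * K) < g ^ (N div 2) * g ^ (M * (L - 1))"
        using H g by (simp add: m_def power_mult)
      also have "\<dots> \<le> g ^ (N * L)"
        using block_exponent_le[of L M N] L M(1) block g
        by (auto simp: power_add[symmetric] add.commute intro!: power_increasing)
      finally show ?thesis by (simp add: H_def L_def)
    qed
    obtain r where r: "r \<in> A" using False by (auto simp: A_def)
    define T where "T q = N * L * multiplicity q g" for q
    \<comment> \<open>The primes at which \<open>x\<close> has sign plus relative to
      \<open>r\<close>, including those where both signs hold.\<close>
    define pat where "pat x = {q \<in> prime_factors g. q ^ T q dvd D * (poly P r * Y x - poly P x * Y r)}" for x
    have primes: "q \<in> prime_factors g \<longleftrightarrow> Factorial_Ring.prime q \<and> q dvd g" for q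
      using g by (auto simp: prime_factors_dvd)
    have sign: "q ^ T q dvd D * (poly P r * Y x - (if q \<in> pat x then 1 else -1) * poly P x * Y r)"
      if x: "x \<in> A" and q: "Factorial_Ring.prime q" "q dvd g" for x q
    proof -
      obtain n k where nk: "n \<in> Z" "k \<in> Z" "x = g ^ n" "r = g ^ k" using x r by (auto simp: A_def)
      have "q ^ T q dvd D * (poly P r * Y x - poly P x * Y r) \<or>
          q ^ T q dvd D * (poly P r * Y x + poly P x * Y r)"
        unfolding nk T_def D_def
        by (rule square_points_sign[OF g q c_def[symmetric] _ G approx s])
          (use N block[OF nk(1)] block[OF nk(2)] Y[OF x] Y[OF r] nk F(3) in \<open>auto simp: N0_def c_def\<close>)
      then show ?thesis using q primes by (auto simp: pat_def)
    qed
    have per_sign: "card {x \<in> A. pat x = S} \<le> 2 * K" for S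
    proof (cases "card {x \<in> A. pat x = S} \<le> K")
      case False
      have vanish: "divided_difference X' (\<lambda>x. of_int (Y x)) = 0"
        if X': "X' \<subseteq> {x \<in> A. pat x = S}" "card X' = K + 1" for X'
      proof (rule divided_difference_vanishes[OF g X'(2) _ _ _ D G(2) _ _ size])
        show "g ^ N dvd x \<and> 0 < x \<and> x \<le> m" if "x \<in> X'" for x using pts that X' by auto
        show "\<bar>Y x\<bar> \<le> B * m ^ d" if "x \<in> X'" for x using Yle that X' by auto
        obtain k where k: "k \<in> Z" "r = g ^ k" using r by (auto simp: A_def)
        have "multiplicity q (poly P r) = multiplicity q G \<and> poly P r \<noteq> 0"
          if q: "Factorial_Ring.prime q" "q dvd g" for q
          using poly_at_power_multiplicity[OF g q, of P k] G k block[OF k(1)] N by (auto simp: N0_def)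
        \<comment> \<open>Nonvanishing of \<open>poly P r\<close> is read off from one prime divisor
          of \<open>g\<close>.\<close>
        moreover have "\<exists>q::int. Factorial_Ring.prime q \<and> q dvd g"
          using g prime_divisor_exists[of g] by auto
        ultimately show "poly P r \<noteq> 0"
          and "\<And>q. Factorial_Ring.prime q \<Longrightarrow> q dvd g \<Longrightarrow> multiplicity q (poly P r) = multiplicity q G"
          by auto
        show "\<exists>e. \<forall>x\<in>X'. q ^ (N * (K * (K + 1)) * multiplicity q g) dvd
            D * (poly P r * Y x - e * poly P x * Y r)"
          if q: "Factorial_Ring.prime q" "q dvd g" for q
        proof (intro exI ballI)
          fix x assume "x \<in> X'"
          then have x: "x \<in> A" "pat x = S" using X'(1) by auto
          \<comment> \<open>Inside a class the sign depends on \<open>q\<close> only, so it can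
            serve as the common multiplier.\<close>
          show "q ^ (N * (K * (K + 1)) * multiplicity q g) dvd
              D * (poly P r * Y x - (if q \<in> S then 1 else -1) * poly P x * Y r)"
            using sign[OF x(1) q] unfolding x(2) T_def L_def .
        qed
      qed
      have "\<exists>Q :: complex poly. Polynomial.degree Q \<le> K - 1 \<and>
          (\<forall>x\<in>{x \<in> A. pat x = S}. poly Q (of_int x) = of_int (Y x))"
        by (rule interpolation_if_divided_differences_vanish[OF _ K _ vanish]) (use False finA in auto)
      then obtain Q :: "complex poly" where Q: "Polynomial.degree Q \<le> K - 1"
        "\<And>x. x \<in> A \<Longrightarrow> pat x = S \<Longrightarrow> poly Q (of_int x) = of_int (Y x)"
        by blast
      have "card {x \<in> A. pat x = S} \<le> 2 * Polynomial.degree F"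
        by (rule interpolated_square_points_bound[OF F(1,2), of Q _ Y s])
          (use Q Y in \<open>auto simp: K_def d_def\<close>)
      then show ?thesis by (simp add: K_def d_def)
    qed auto
    have "card A \<le> card (Pow (prime_factors g)) * (2 * K)"
      by (rule card_le_fibres[of A _ pat]) (use finA per_sign in \<open>auto simp: pat_def\<close>)
    then show ?thesis by (simp add: b_def cardA card_Pow)
  qed (simp add: b_def)
  then show ?thesis using L by (intro exI[of _ N0] exI[of _ b] exI[of _ L]) auto
qed

section \<open>Quadratic fields\<close>

text \<open>After division by the gcd \<open>d\<close>, the cofactor \<open>a\<close> of
  \<open>s\<close> is coprime to \<open>b\<close> and divides \<open>d * b\<^sup>2\<close>, hence
  \<open>d\<close>. So \<open>a\<^sup>2\<close> divides \<open>s\<close> and \<open>a\<close> is a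
  unit.\<close>

lemma squarefree_dvd_if_dvd_square:
  fixes s u w :: int
  assumes "squarefree s" "s * u = w\<^sup>2"
  shows "s dvd w"
proof (cases "s = 0")
  case False
  define d where "d = gcd s w"
  have d: "d \<noteq> 0" using False by (simp add: d_def)
  obtain a b where ab: "s = a * d" "w = b * d" "coprime a b"
    using gcd_coprime_exists[of s w] d unfolding d_def by blast
  have "d * (a * u) = d * (d * b\<^sup>2)"
    using assms(2) unfolding ab(1,2) by (simp add: power2_eq_square mult_ac)
  then have "a * u = d * b\<^sup>2" using d by simp
  then have "a dvd d * b\<^sup>2" by (metis dvd_triv_left)
  then have "a dvd d" using ab(3) by (simp add: coprime_dvd_mult_left_iff)
  then have "a\<^sup>2 dvd s" unfolding ab(1) power2_eq_square by (intro mult_dvd_mono) auto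
  then have "is_unit a" using assms(1) squarefreeD by blast
  then show ?thesis unfolding ab(1,2) by (metis dvd_refl mult_dvd_mono unit_imp_dvd)
qed (use assms in auto)

text \<open>Serves to strip even powers of \<open>g\<close>. After removal of the gcd, the square of
  the cofactor of \<open>t\<close> divides \<open>s\<close>.\<close>

lemma dvd_if_square_dvd_squarefree_mult_square:
  fixes s t y v :: int
  assumes "squarefree s" "s * y\<^sup>2 = t\<^sup>2 * v" "t \<noteq> 0"
  shows "t dvd y"
proof -
  define d where "d = gcd t y"
  have d: "d \<noteq> 0" using assms by (simp add: d_def)
  obtain a b where ab: "t = a * d" "y = b * d" "coprime a b"
    using gcd_coprime_exists[of t y] d unfolding d_def by blast
  have "d\<^sup>2 * (s * b\<^sup>2) = d\<^sup>2 * (a\<^sup>2 * v)"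
    using assms(2) unfolding ab(1,2) by (simp add: power_mult_distrib mult_ac)
  then have "s * b\<^sup>2 = a\<^sup>2 * v" using d by simp
  then have "a\<^sup>2 dvd s * b\<^sup>2" by simp
  then have "a\<^sup>2 dvd s" using ab(3) by (simp add: coprime_dvd_mult_left_iff)
  then have "is_unit a" using assms(1) squarefreeD by blast
  then show ?thesis unfolding ab(1,2) by (metis dvd_refl mult_dvd_mono unit_imp_dvd)
qed

text \<open>Numbers of this form are closed under the field operations; inverses come from
  multiplying by the conjugate.\<close>

lemma quadratic_field_subset:
  assumes "x \<in> quadratic_field a"
  shows "\<exists>p\<in>\<rat>. \<exists>q\<in>\<rat>. x = p + q * csqrt (of_int a)"
  using assms unfolding quadratic_field_def
proof (induction rule: generate_field.induct)
  case one
  show ?case by (intro bexI[of _ 1] bexI[of _ 0]) (auto simp: ring_of_type_algebra_def)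
next
  case (incl h)
  then consider "h \<in> \<rat>" | "h = csqrt (of_int a)" by auto
  then show ?case
  proof cases
    case 1
    then show ?thesis by (intro bexI[of _ h] bexI[of _ 0]) auto
  next
    case 2
    then show ?thesis by (intro bexI[of _ 0] bexI[of _ 1]) auto
  qed
next
  case (a_inv h)
  then obtain p q where pq: "p \<in> \<rat>" "q \<in> \<rat>" "h = p + q * csqrt (of_int a)" by auto
  interpret field "complex_ring" by (rule field_from_type_algebra)
  have "\<ominus>\<^bsub>complex_ring\<^esub> h = - h"
    by (rule minus_equality) (auto simp: ring_of_type_algebra_def)
  then show ?case using pq by (intro bexI[of _ "- p"] bexI[of _ "- q"]) auto
next
  case (m_inv h)
  define r where "r = csqrt (of_int a)"
  from m_inv obtain p q where pq: "p \<in> \<rat>" "q \<in> \<rat>" "h = p + q * r" by (auto simp: r_def)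
  interpret field "complex_ring" by (rule field_from_type_algebra)
  have h: "h \<noteq> 0" using m_inv by (simp add: ring_of_type_algebra_def)
  have inv: "inv\<^bsub>complex_ring\<^esub> h = 1 / h"
    using h by (intro comm_inv_char) (auto simp: ring_of_type_algebra_def)
  have r2: "r * r = of_int a" unfolding r_def by (metis power2_csqrt power2_eq_square)
  have "\<exists>p\<in>\<rat>. \<exists>q\<in>\<rat>. inv\<^bsub>complex_ring\<^esub> h = p + q * r"
  \<comment> \<open>The conjugate of a nonzero \<open>h\<close> can vanish when \<open>r\<close> is
    rational; then \<open>h = 2 * p\<close>.\<close>
  proof (cases "p - q * r = 0")
    case True
    then have "1 / h = 1 / (2 * p) + 0 * r" using pq by simp
    then show ?thesis unfolding inv using pq(1) by (intro bexI[of _ "1 / (2 * p)"] bexI[of _ 0]) auto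
  next
    case False
    define w where "w = p * p - q * q * of_int a"
    have w: "w = h * (p - q * r)" unfolding w_def pq(3) by (simp add: algebra_simps r2[symmetric])
    have "1 / h = (p - q * r) / w" using False h unfolding w by simp
    then have "1 / h = p / w + (- q / w) * r" by (simp add: diff_divide_distrib)
    moreover have "w \<in> \<rat>" unfolding w_def using pq by auto
    ultimately show ?thesis unfolding inv using pq
      by (intro bexI[of _ "p / w"] bexI[of _ "- q / w"]) auto
  qed
  then show ?case unfolding r_def .
next
  case (eng_add h k)
  then obtain p q p' q' where pq: "p \<in> \<rat>" "q \<in> \<rat>" "h = p + q * csqrt (of_int a)"
    "p' \<in> \<rat>" "q' \<in> \<rat>" "k = p' + q' * csqrt (of_int a)" by metis
  then show ?case by (intro bexI[of _ "p + p'"] bexI[of _ "q + q'"])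
      (auto simp: ring_of_type_algebra_def algebra_simps)
next
  case (eng_mult h k)
  define r where "r = csqrt (of_int a)"
  from eng_mult obtain p q p' q' where pq: "p \<in> \<rat>" "q \<in> \<rat>" "h = p + q * r"
    "p' \<in> \<rat>" "q' \<in> \<rat>" "k = p' + q' * r" unfolding r_def by metis
  have r2: "r * r = of_int a" unfolding r_def by (metis power2_csqrt power2_eq_square)
  have "h * k = (p * p' + q * q' * of_int a) + (p * q' + q * p') * r"
    unfolding pq(3,6) by (simp add: algebra_simps r2[symmetric])
  then show ?case unfolding r_def[symmetric] using pq
    by (intro bexI[of _ "p * p' + q * q' * of_int a"] bexI[of _ "p * q' + q * p'"])
      (auto simp: ring_of_type_algebra_def)
qed

lemma csqrt_mem_quadratic_field: "csqrt (of_int a) \<in> quadratic_field a"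
  unfolding quadratic_field_def by (intro generate_field.incl) auto

text \<open>Squaring \<open>t = p + q * r\<close> forces \<open>p * q = 0\<close> when
  \<open>t\<close>, and hence \<open>r\<close>, is irrational; so \<open>r * t\<close> is rational
  in every case. It is also an algebraic integer, its square being \<open>a * b\<close>, and
  therefore an integer.\<close>

lemma quadratic_field_eq_imp_mult_square:
  assumes eq: "quadratic_field a = quadratic_field b"
  shows "\<exists>w. a * b = w\<^sup>2"
proof -
  define r t where "r = csqrt (of_int a)" and "t = csqrt (of_int b)"
  have r2: "r * r = of_int a" "t * t = of_int b"
    unfolding r_def t_def by (metis power2_csqrt power2_eq_square)+
  obtain p q where pq: "p \<in> \<rat>" "q \<in> \<rat>" "t = p + q * r"
    using quadratic_field_subset[of t a] csqrt_mem_quadratic_field[of b] eq by (auto simp: r_def t_def)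
  obtain p' q' where pq': "p' \<in> \<rat>" "q' \<in> \<rat>" "r = p' + q' * t"
    using quadratic_field_subset[of r b] csqrt_mem_quadratic_field[of a] eq by (auto simp: r_def t_def)
  have "r * t \<in> \<rat>"
  proof (cases "t \<in> \<rat>")
    case True
    then have "r \<in> \<rat>" unfolding pq'(3) using pq' by auto
    then show ?thesis using True by auto
  next
    case False
    have "of_int b = p * p + q * q * of_int a + 2 * p * q * r"
      unfolding r2[symmetric] by (subst (1 2) pq(3)) (simp add: algebra_simps)
    then have "(2 * p * q) * r = of_int b - p * p - q * q * of_int a" by simp
    moreover have "r \<notin> \<rat>" using False pq by auto
    moreover have "r = (of_int b - p * p - q * q * of_int a) / (2 * p * q)" if "2 * p * q \<noteq> 0"
      using calculation(1) that by (simp add: field_simps)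
    ultimately have "2 * p * q = 0" using pq(1,2)
      by (metis Rats_diff Rats_divide Rats_mult Rats_number_of Rats_of_int)
    moreover have "q \<noteq> 0" using False pq by auto
    ultimately have "t = q * r" using pq(3) by simp
    then have "r * t = q * of_int a" using r2(1) by simp
    then show ?thesis using pq by simp
  qed
  moreover have sq: "(r * t)\<^sup>2 = of_int (a * b)"
    using r2 by (simp add: power2_eq_square mult_ac)
  then have "algebraic_int ((r * t)\<^sup>2)" by (simp only: algebraic_int_of_int)
  then have "algebraic_int (r * t)"
    by (rule algebraic_int_root[where p = "Polynomial.monom 1 2"])
      (auto simp: poly_monom degree_monom_eq)
  ultimately obtain w where "r * t = of_int w"
    using rational_algebraic_int_is_int by (metis Ints_cases)
  then have "of_int (a * b) = (of_int (w\<^sup>2) :: complex)" using sq by simp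
  then show ?thesis by (metis of_int_eq_iff)
qed

text \<open>The root of the square \<open>s * u\<close> is divisible by \<open>s\<close>. This
  passes from fields to the equation counted in blocks.\<close>

lemma quadratic_field_eq_imp_squarefree_part:
  assumes "quadratic_field u = quadratic_field s" "squarefree s" "s > 0"
  shows "\<exists>y. u = s * y\<^sup>2"
proof -
  obtain w where w: "s * u = w\<^sup>2"
    using quadratic_field_eq_imp_mult_square[OF assms(1)] by (metis mult.commute)
  then obtain y where "w = s * y" using squarefree_dvd_if_dvd_square[OF assms(2) w] by (auto elim: dvdE)
  then have "s * u = s * (s * y\<^sup>2)" using w by (simp add: power2_eq_square mult_ac)
  then show ?thesis using assms(3) by auto
qed

lemma quadratic_field_inj_on_squarefree:
  assumes "quadratic_field s = quadratic_field t" "squarefree s" "squarefree t" "s > 0" "t > 0"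
  shows "s = t"
proof -
  obtain y where y: "s = t * y\<^sup>2"
    using quadratic_field_eq_imp_squarefree_part[OF assms(1,3,5)] by blast
  then have "is_unit y" using assms(2) squarefreeD[of s y] by simp
  then have "y\<^sup>2 = 1" by (auto simp: power2_eq_1_iff)
  then show ?thesis using y by simp
qed

section \<open>Exponents in an interval and the trivial bound\<close>

definition exponent_interval :: "int \<Rightarrow> nat \<Rightarrow> nat set" where
  "exponent_interval M N = {n. n \<ge> 1 \<and> int n \<in> {M + 1..M + int N}}"

lemma finite_exponent_interval: "finite (exponent_interval M N)"
  and card_exponent_interval_le: "card (exponent_interval M N) \<le> N"
proof -
  have sub: "int ` exponent_interval M N \<subseteq> {M + 1..M + int N}" by (auto simp: exponent_interval_def)
  then have "finite (int ` exponent_interval M N)" using finite_subset by blast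
  then show "finite (exponent_interval M N)" by (simp add: finite_image_iff inj_on_def)
  have "card (int ` exponent_interval M N) \<le> card {M + 1..M + int N}" using sub by (intro card_mono) auto
  then show "card (exponent_interval M N) \<le> N" by (simp add: card_image inj_on_def)
qed

text \<open>A field belongs to at most one positive squarefree \<open>s\<close>, so the sets counted
  for different \<open>s\<close> are disjoint.\<close>

lemma Q_sum_le_interval_length: "Q_sum u M N S \<le> N"
proof -
  let ?I = "exponent_interval M N"
  let ?A = "\<lambda>s. {n \<in> ?I. quadratic_field (u n) = quadratic_field s}"
  let ?S = "{s \<in> {1..S}. squarefree s}"
  have "Q_sum u M N S = (\<Sum>s\<in>?S. card (?A s))"
    unfolding Q_sum_def Q_count_def exponent_interval_def
    by (intro sum.cong arg_cong[where f = card]) auto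
  also have "\<dots> = card (\<Union>s\<in>?S. ?A s)"
  proof (rule card_UN_disjoint[symmetric])
    show "\<forall>s\<in>?S. finite (?A s)" using finite_exponent_interval by auto
    show "\<forall>s\<in>?S. \<forall>t\<in>?S. s \<noteq> t \<longrightarrow> ?A s \<inter> ?A t = {}"
      using quadratic_field_inj_on_squarefree by fastforce
    show "finite ?S" by (rule finite_subset[of _ "{1..S}"]) auto
  qed
  also have "\<dots> \<le> card ?I" using finite_exponent_interval by (intro card_mono) auto
  also have "\<dots> \<le> N" by (rule card_exponent_interval_le)
  finally show ?thesis .
qed

text \<open>The lower bound is positive for some large \<open>z\<close>, so there is a prime
  \<open>l\<close> with \<open>l powr \<alpha>\<close> at most the largest prime divisor of
  \<open>l - 1\<close>, which is less than \<open>l\<close>.\<close>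

lemma largest_prime_divisor_density_exponent_less_1:
  assumes "\<alpha> > 0"
    and "\<exists>c>0. \<forall>\<^sub>F z :: real in at_top.
           z / ln z \<le> c * real (card {l :: nat. real l \<le> z \<and> Factorial_Ring.prime l \<and>
             real (largest_prime_divisor (l - 1)) \<ge> real l powr \<alpha>})"
  shows "\<alpha> < 1"
proof -
  define A where "A z = {l :: nat. real l \<le> z \<and> Factorial_Ring.prime l \<and>
             real (largest_prime_divisor (l - 1)) \<ge> real l powr \<alpha>}" for z :: real
  obtain c where "\<forall>\<^sub>F z :: real in at_top. z / ln z \<le> c * real (card (A z))"
    using assms(2) unfolding A_def by blast
  then have "\<forall>\<^sub>F z :: real in at_top. z > 2 \<and> z / ln z \<le> c * real (card (A z))"
    using eventually_gt_at_top eventually_conj by blast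
  then obtain z :: real where z: "z > 2" "z / ln z \<le> c * real (card (A z))"
    by (metis (mono_tags, lifting) eventually_happens trivial_limit_at_top_linorder)
  have "z / ln z > 0" using z(1) by simp
  then have "A z \<noteq> {}" using z(2) by force
  then obtain l where l: "Factorial_Ring.prime l" "real (largest_prime_divisor (l - 1)) \<ge> real l powr \<alpha>"
    by (auto simp: A_def)
  have l2: "l \<ge> 2" using l(1) prime_ge_2_nat by blast
  have "largest_prime_divisor (l - 1) \<le> l - 1"
  proof (cases "l - 1 \<ge> 2")
    case True
    have "prime_factors (l - 1) \<noteq> {}" using True by (auto simp: prime_factorization_empty_iff)
    then have "Max (prime_factors (l - 1)) \<in> prime_factors (l - 1)" by (intro Max_in) auto
    then have "Max (prime_factors (l - 1)) dvd l - 1" by auto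
    then show ?thesis using True by (simp add: largest_prime_divisor_def dvd_imp_le)
  next
    case False
    \<comment> \<open>Here \<open>l = 2\<close>, and the conventional value 1 equals
      \<open>l - 1\<close>.\<close>
    then show ?thesis using l2 by (simp add: largest_prime_divisor_def)
  qed
  then have "real l powr \<alpha> < real l powr 1" using l l2 by simp
  then show ?thesis using l2 powr_less_cancel_iff[of "real l" \<alpha> 1] by simp
qed

section \<open>Counting exponents\<close>

text \<open>On a logarithmic scale the exponents from \<open>N0\<close> on lie in a segment of
  length at most \<open>ln N\<close>. Cells of length \<open>\<mu>\<close> cut it into blocks whose
  members have ratio below \<open>1 + 1 / (2 * L)\<close>.\<close>

lemma card_le_if_blocks_bounded:
  fixes W :: "nat set" and L N0 b N :: nat
  assumes L: "L \<ge> 1" and N: "N \<ge> 1"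
    and block: "\<And>n0 Z. N0 \<le> n0 \<Longrightarrow> Z \<subseteq> W \<Longrightarrow>
      (\<And>n. n \<in> Z \<Longrightarrow> n0 \<le> n \<and> 2 * L * n \<le> (2 * L + 1) * n0) \<Longrightarrow> card Z \<le> b"
    and W: "W \<subseteq> exponent_interval M N"
  defines "\<mu> \<equiv> ln (1 + 1 / (2 * real L))"
  shows "real (card W) \<le> (real N0 + 2 * real b + real b / \<mu>) * (1 + ln (real N))"
proof -
  have fin: "finite W" using W finite_exponent_interval finite_subset by blast
  have \<mu>: "\<mu> > 0" unfolding \<mu>_def using L by (intro ln_gt_zero) simp
  define V where "V = {n \<in> W. n \<ge> N0}"
  have finV: "finite V" and VW: "V \<subseteq> W" using fin by (auto simp: V_def)
  have pos: "n \<ge> 1" if "n \<in> W" for n using that W by (auto simp: exponent_interval_def)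
  have "card W \<le> card ({..<N0} \<union> V)" using finV by (intro card_mono) (auto simp: V_def)
  also have "\<dots> \<le> N0 + card V" using card_Un_le[of "{..<N0}" V] by simp
  finally have WV: "card W \<le> N0 + card V" .
  have lnN: "ln (real N) \<ge> 0" using N by simp
  have "real (card V) \<le> (ln (real N) / \<mu> + 2) * real b"
  proof (cases "V = {}")
    case True
    then show ?thesis using lnN \<mu> by simp
  next
    case False
    define lo hi where "lo = Min V" and "hi = Max V"
    define idx where "idx n = \<lfloor>ln (real n) / \<mu>\<rfloor>" for n :: nat
    have lohi: "lo \<in> V" "hi \<in> V" "\<And>n. n \<in> V \<Longrightarrow> lo \<le> n \<and> n \<le> hi"
      using False finV by (auto simp: lo_def hi_def)
    have lo1: "lo \<ge> 1" using lohi VW pos by auto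
    have "int lo \<ge> M + 1" "int hi \<le> M + int N"
      using lohi(1,2) VW W by (auto simp: exponent_interval_def)
    then have "int hi < int lo + int N" by linarith
    then have "hi + 1 \<le> lo + N" by linarith
    \<comment> \<open>This is \<open>(lo - 1) * (N - 1) \<ge> 0\<close>; it makes the logarithmic
      length independent of \<open>M\<close>.\<close>
    also have "lo + N \<le> lo * N + 1"
      using lo1 N by (cases lo; cases N) auto
    finally have "hi \<le> lo * N" by simp
    then have "real hi \<le> real lo * real N" by (simp flip: of_nat_mult)
    moreover have "hi \<ge> 1" using lohi VW pos by auto
    ultimately have "ln (real hi) \<le> ln (real lo * real N)" by simp
    then have lnhi: "ln (real hi) \<le> ln (real lo) + ln (real N)"
      using lo1 N by (simp add: ln_mult)
    have fibre: "card {n \<in> V. idx n = i} \<le> b" for i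
    proof (cases "{n \<in> V. idx n = i} = {}")
      case False
      define n0 where "n0 = Min {n \<in> V. idx n = i}"
      have n0: "n0 \<in> V" "idx n0 = i" "\<And>n. n \<in> V \<Longrightarrow> idx n = i \<Longrightarrow> n0 \<le> n"
        using False finV Min_in[of "{n \<in> V. idx n = i}"] by (auto simp: n0_def)
      show ?thesis
      proof (rule block[of n0])
        show "N0 \<le> n0" using n0 by (simp add: V_def)
        show "{n \<in> V. idx n = i} \<subseteq> W" using VW by auto
        fix n assume n: "n \<in> {n \<in> V. idx n = i}"
        have ratio: "1 + 1 / (2 * real L) > 0" by (simp add: add_pos_nonneg)
        have p: "n \<ge> 1" "n0 \<ge> 1" using n n0 VW pos by auto
        have "\<lfloor>ln (real n) / \<mu>\<rfloor> = \<lfloor>ln (real n0) / \<mu>\<rfloor>" using n n0(2) by (simp add: idx_def)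
        then have "ln (real n) / \<mu> < ln (real n0) / \<mu> + 1" by linarith
        then have "ln (real n) < ln (real n0) + \<mu>" using \<mu> by (simp add: field_simps)
        also have "\<dots> = ln (real n0 * (1 + 1 / (2 * real L)))"
          unfolding \<mu>_def using p ratio by (subst ln_mult) auto
        finally have "real n < real n0 * (1 + 1 / (2 * real L))"
          using p ratio by (subst (asm) ln_less_cancel_iff) auto
        then have "real (2 * L * n) \<le> real ((2 * L + 1) * n0)"
          using L by (simp add: field_simps)
        then show "n0 \<le> n \<and> 2 * L * n \<le> (2 * L + 1) * n0"
          using n n0(3) by (simp only: of_nat_le_iff) auto
      qed
    next
      case True
      show ?thesis unfolding True by simp
    qed
    have "idx ` V \<subseteq> {idx lo..idx hi}"
    proof
      fix i assume "i \<in> idx ` V"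
      then obtain n where n: "n \<in> V" "i = idx n" by auto
      have "ln (real lo) \<le> ln (real n)" "ln (real n) \<le> ln (real hi)"
        using lohi(3)[OF n(1)] lo1 by auto
      then show "i \<in> {idx lo..idx hi}"
        using \<mu> by (auto simp: n idx_def intro!: floor_mono divide_right_mono)
    qed
    then have "card V \<le> card {idx lo..idx hi} * b"
      using fibre finV by (intro card_le_fibres[of _ _ idx]) auto
    then have "real (card V) \<le> real (card {idx lo..idx hi}) * real b"
      by (simp flip: of_nat_mult)
    also have "real (card {idx lo..idx hi}) \<le> ln (real N) / \<mu> + 2"
    proof -
      have "ln (real hi) / \<mu> \<le> ln (real lo) / \<mu> + ln (real N) / \<mu>"
        using lnhi \<mu> by (simp add: field_simps)
      moreover have nonneg: "0 \<le> ln (real N) / \<mu>" using lnN \<mu> by simp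
      \<comment> \<open>Rounding costs less than one, and both end cells are counted.\<close>
      ultimately have "real_of_int (idx hi + 1 - idx lo) \<le> ln (real N) / \<mu> + 2"
        unfolding idx_def by linarith
      then show ?thesis using nonneg by (cases "idx lo \<le> idx hi + 1") (auto simp: add.commute)
    qed
    finally show ?thesis by (simp add: mult_right_mono)
  qed
  then have "real (card W) \<le> real N0 + (ln (real N) / \<mu> + 2) * real b" using WV by linarith
  also have "\<dots> \<le> \<dots> + (real N0 * ln (real N) + 2 * real b * ln (real N) + real b / \<mu>)"
    using lnN \<mu> by simp
  also have "\<dots> = (real N0 + 2 * real b + real b / \<mu>) * (1 + ln (real N))"
    by (simp add: algebra_simps)
  finally show ?thesis .
qed

lemma card_square_points_le_nonzero_constant:
  fixes F :: "int poly" and g :: int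
  assumes g: "g > 1" and F: "rsquarefree (map_poly of_int F :: complex poly)"
    "Polynomial.degree F \<ge> 1" "poly F 0 \<noteq> 0"
  obtains C where "C \<ge> 0" "\<And>s M N. squarefree s \<Longrightarrow> s > 0 \<Longrightarrow> N \<ge> 1 \<Longrightarrow>
    real (card {n \<in> exponent_interval M N. \<exists>y. poly F (g ^ n) = s * y\<^sup>2}) \<le> C * (1 + ln (real N))"
proof -
  obtain N0 b L where L: "L \<ge> 1" and block: "\<forall>s N Z. squarefree s \<longrightarrow> s > 0 \<longrightarrow> N0 \<le> N \<longrightarrow> finite Z \<longrightarrow>
    (\<forall>n\<in>Z. N \<le> n \<and> 2 * L * n \<le> (2 * L + 1) * N \<and> (\<exists>y. poly F (g ^ n) = s * y\<^sup>2)) \<longrightarrow>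
    card Z \<le> b"
    using square_points_in_block_bounded[OF assms] by blast
  define C where "C = real N0 + 2 * real b + real b / ln (1 + 1 / (2 * real L))"
  have "real (card {n \<in> exponent_interval M N. \<exists>y. poly F (g ^ n) = s * y\<^sup>2}) \<le> C * (1 + ln (real N))"
    if s: "squarefree s" "s > 0" "N \<ge> 1" for s :: int and M N
    unfolding C_def
  proof (rule card_le_if_blocks_bounded[OF L s(3)])
    let ?W = "{n \<in> exponent_interval M N. \<exists>y. poly F (g ^ n) = s * y\<^sup>2}"
    show "?W \<subseteq> exponent_interval M N" by auto
    fix n0 Z assume Z: "N0 \<le> n0" "Z \<subseteq> ?W" "\<And>n. n \<in> Z \<Longrightarrow> n0 \<le> n \<and> 2 * L * n \<le> (2 * L + 1) * n0"
    have "finite ?W" using finite_exponent_interval by auto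
    then have "finite Z" using Z(2) finite_subset by blast
    then show "card Z \<le> b" using Z s(1,2) by (intro block[rule_format, of s n0]) auto
  qed
  moreover have "C \<ge> 0" unfolding C_def using L by (intro add_nonneg_nonneg divide_nonneg_nonneg) auto
  ultimately show ?thesis by (intro that[of C])
qed

text \<open>A root of \<open>f\<close> at 0 is simple, so the cofactor \<open>h\<close> does not
  vanish there. Degree at least 2 keeps \<open>h\<close> nonconstant, and the parity of
  \<open>n\<close> decides between \<open>h\<close> and \<open>k\<close>.\<close>

lemma card_square_points_le:
  fixes f :: "int poly" and g :: int
  assumes g: "g > 1" and f: "rsquarefree (map_poly of_int f :: complex poly)"
    "Polynomial.degree f \<ge> 2"
  obtains C where "C \<ge> 0" "\<And>s M N. squarefree s \<Longrightarrow> s > 0 \<Longrightarrow> N \<ge> 1 \<Longrightarrow>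
    real (card {n \<in> exponent_interval M N. \<exists>y. poly f (g ^ n) = s * y\<^sup>2}) \<le> C * (1 + ln (real N))"
proof (cases "poly f 0 = 0")
  case False
  moreover have "Polynomial.degree f \<ge> 1" using f(2) by simp
  ultimately show ?thesis using card_square_points_le_nonzero_constant[OF g f(1)] that by blast
next
  case True
  obtain a h where "f = pCons a h" by (cases f) auto
  then have h: "f = pCons 0 h" using True by simp
  \<comment> \<open>dividing \<open>g ^ n * h (g ^ n)\<close> by an even power of \<open>g\<close> leaves a value of \<open>h\<close> or of \<open>g * h\<close>\<close>
  define k where "k = Polynomial.smult g h"
  have "h \<noteq> 0" using f(2) h by auto
  then have deg: "Polynomial.degree h \<ge> 1" "Polynomial.degree k \<ge> 1"
    using f(2) h g by (auto simp: k_def)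
  let ?c = "map_poly of_int :: int poly \<Rightarrow> complex poly"
  have cf: "?c f = pCons 0 (?c h)" by (simp add: h map_poly_pCons)
  \<comment> \<open>The second polynomial is the derivative of the first by the product
    rule.\<close>
  have simple: "\<not> (poly (pCons 0 (?c h)) z = 0 \<and> poly (?c h + pCons 0 (pderiv (?c h))) z = 0)" for z
    using f(1) unfolding cf rsquarefree_roots pderiv_pCons by blast
  have h_sf: "rsquarefree (?c h)"
    unfolding rsquarefree_roots using simple by fastforce
  have ck: "?c k = Polynomial.smult (of_int g) (?c h)"
    by (rule poly_eqI) (simp add: k_def coeff_map_poly)
  have k_sf: "rsquarefree (?c k)"
    using h_sf g unfolding ck rsquarefree_roots by (simp add: pderiv_smult)
  have "poly (?c h) 0 \<noteq> 0" using simple[of 0] by simp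
  then have h0: "poly h 0 \<noteq> 0" using poly_map_poly_of_int[of h 0, where 'a = complex] by auto
  then have k0: "poly k 0 \<noteq> 0" using g by (simp add: k_def)
  obtain C1 where C1: "C1 \<ge> 0" "\<And>s M N. squarefree s \<Longrightarrow> s > 0 \<Longrightarrow> N \<ge> 1 \<Longrightarrow>
    real (card {n \<in> exponent_interval M N. \<exists>y. poly h (g ^ n) = s * y\<^sup>2}) \<le> C1 * (1 + ln (real N))"
    by (rule card_square_points_le_nonzero_constant[OF g h_sf deg(1) h0]) (rule that)
  obtain C2 where C2: "C2 \<ge> 0" "\<And>s M N. squarefree s \<Longrightarrow> s > 0 \<Longrightarrow> N \<ge> 1 \<Longrightarrow>
    real (card {n \<in> exponent_interval M N. \<exists>y. poly k (g ^ n) = s * y\<^sup>2}) \<le> C2 * (1 + ln (real N))"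
    by (rule card_square_points_le_nonzero_constant[OF g k_sf deg(2) k0]) (rule that)
  have "real (card {n \<in> exponent_interval M N. \<exists>y. poly f (g ^ n) = s * y\<^sup>2}) \<le> (C1 + C2) * (1 + ln (real N))"
    if s: "squarefree s" "s > 0" and N: "N \<ge> 1" for s :: int and M N
  proof -
    let ?A = "\<lambda>p. {n \<in> exponent_interval M N. \<exists>y. poly p (g ^ n) = s * y\<^sup>2}"
    have fin: "finite (?A p)" for p using finite_exponent_interval by auto
    have "?A f \<subseteq> ?A h \<union> ?A k"
    proof
      fix n assume n: "n \<in> ?A f"
      then obtain y where y: "poly f (g ^ n) = s * y\<^sup>2" by auto
      define m where "m = n div 2"
      define v where "v = (if even n then poly h (g ^ n) else poly k (g ^ n))"
      have "n = 2 * m \<or> n = Suc (2 * m)" unfolding m_def by presburger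
      then have "g ^ n = (g ^ m)\<^sup>2 * (if even n then 1 else g)"
        by (auto simp: power_mult[symmetric] mult.commute)
      then have "s * y\<^sup>2 = (g ^ m)\<^sup>2 * v"
        unfolding y[symmetric] h poly_pCons v_def k_def by (simp add: mult_ac)
      moreover have "g ^ m \<noteq> 0" using g by simp
      ultimately obtain z where "y = g ^ m * z" "s * y\<^sup>2 = (g ^ m)\<^sup>2 * v"
        using dvd_if_square_dvd_squarefree_mult_square[OF s(1)] by (metis dvdE)
      then have "(g ^ m)\<^sup>2 * (s * z\<^sup>2) = (g ^ m)\<^sup>2 * v" by (simp add: power_mult_distrib mult_ac)
      then have "v = s * z\<^sup>2" using g by simp
      then show "n \<in> ?A h \<union> ?A k" using n by (auto simp: v_def split: if_splits)
    qed
    then have "card (?A f) \<le> card (?A h \<union> ?A k)" using fin by (intro card_mono) auto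
    also have "\<dots> \<le> card (?A h) + card (?A k)" by (rule card_Un_le)
    finally have "real (card (?A f)) \<le> real (card (?A h)) + real (card (?A k))" by linarith
    then show ?thesis using C1(2)[OF s N, of M] C2(2)[OF s N, of M] by (simp add: distrib_right)
  qed
  then show ?thesis using that[of "C1 + C2"] C1(1) C2(1) by auto
qed

section \<open>Summation over \<open>s\<close> and the final bound\<close>

lemma Q_sum_le_linear:
  fixes f :: "int poly" and g :: int
  assumes g: "g > 1" and f: "rsquarefree (map_poly of_int f :: complex poly)"
    "Polynomial.degree f \<ge> 2"
  obtains C where "C \<ge> 1" "\<And>M N S. N \<ge> 1 \<Longrightarrow> S \<ge> 1 \<Longrightarrow>
    real (Q_sum (\<lambda>n. poly f (g ^ n)) M N S) \<le> real_of_int S * (C * (1 + ln (real N)))"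
proof -
  obtain C where C: "C \<ge> 0" "\<And>s M N. squarefree s \<Longrightarrow> s > 0 \<Longrightarrow> N \<ge> 1 \<Longrightarrow>
    real (card {n \<in> exponent_interval M N. \<exists>y. poly f (g ^ n) = s * y\<^sup>2}) \<le> C * (1 + ln (real N))"
    by (rule card_square_points_le[OF assms]) (rule that)
  \<comment> \<open>Using \<open>C + 1\<close> gives a constant of at least 1, of which a logarithm
    is taken later.\<close>
  have "real (Q_sum (\<lambda>n. poly f (g ^ n)) M N S) \<le> real_of_int S * ((C + 1) * (1 + ln (real N)))"
    if N: "N \<ge> 1" and S: "S \<ge> 1" for M N S
  proof -
    let ?S = "{s \<in> {1..S}. squarefree s}"
    have lnN: "ln (real N) \<ge> 0" using N by simp
    have Q: "real (Q_count (\<lambda>n. poly f (g ^ n)) M N s) \<le> (C + 1) * (1 + ln (real N))" if s: "s \<in> ?S" for s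
    proof -
      have "finite {n \<in> exponent_interval M N. \<exists>y. poly f (g ^ n) = s * y\<^sup>2}"
        using finite_exponent_interval by simp
      then have "Q_count (\<lambda>n. poly f (g ^ n)) M N s \<le>
          card {n \<in> exponent_interval M N. \<exists>y. poly f (g ^ n) = s * y\<^sup>2}"
        unfolding Q_count_def using s quadratic_field_eq_imp_squarefree_part
        by (intro card_mono) (auto simp: exponent_interval_def)
      then have "real (Q_count (\<lambda>n. poly f (g ^ n)) M N s) \<le> C * (1 + ln (real N))"
        using C(2)[of s N M] s N by simp
      then show ?thesis using lnN by (simp add: distrib_right)
    qed
    have "real (Q_sum (\<lambda>n. poly f (g ^ n)) M N S) \<le> (\<Sum>s\<in>?S. (C + 1) * (1 + ln (real N)))"
      unfolding Q_sum_def of_nat_sum by (rule sum_mono) (rule Q)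
    also have "\<dots> = real (card ?S) * ((C + 1) * (1 + ln (real N)))" by simp
    also have "\<dots> \<le> real_of_int S * ((C + 1) * (1 + ln (real N)))"
    proof (rule mult_right_mono)
      have "card ?S \<le> card {1..S}" by (intro card_mono) auto
      then show "real (card ?S) \<le> real_of_int S" using S by simp
      show "0 \<le> (C + 1) * (1 + ln (real N))" using C(1) lnN by simp
    qed
    finally show ?thesis .
  qed
  then show ?thesis using that[of "C + 1"] C(1) by auto
qed

theorem theorem1p5:
  fixes g :: int and f :: "int poly" and \<alpha> :: real
  assumes "extended_riemann_hypothesis"
    and "g > 1"
    and "Polynomial.degree f \<ge> 3"
    and "Polynomial.lead_coeff f > 0"
    and "rsquarefree (map_poly of_int f :: complex poly)"
    and "\<alpha> > 0"
    and "\<exists>c>0. \<forall>\<^sub>F z :: real in at_top.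
           z / ln z \<le> c * real (card {l :: nat. real l \<le> z \<and> Factorial_Ring.prime l \<and>
             real (largest_prime_divisor (l - 1)) \<ge> real l powr \<alpha>})"
  shows "\<exists>\<eta> :: nat \<Rightarrow> real. \<eta> \<longlonglongrightarrow> 0 \<and>
           (\<forall>(M :: int) (N :: nat) (S :: int). N \<ge> 1 \<longrightarrow> S \<ge> 1 \<longrightarrow>
              real (Q_sum (\<lambda>n. poly f (g ^ n)) M N S)
                \<le> real_of_int S powr (1 / 2) * real N powr (1 / (1 + \<alpha>) + \<eta> N))"
proof -
  have \<alpha>: "\<alpha> < 1" using largest_prime_divisor_density_exponent_less_1[OF assms(6,7)] .
  have deg: "Polynomial.degree f \<ge> 2" using assms(3) by simp
  obtain C where C: "C \<ge> 1" "\<And>M N S. N \<ge> 1 \<Longrightarrow> S \<ge> 1 \<Longrightarrow>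
    real (Q_sum (\<lambda>n. poly f (g ^ n)) M N S) \<le> real_of_int S * (C * (1 + ln (real N)))"
    by (rule Q_sum_le_linear[OF assms(2,5) deg]) (rule that)
  \<comment> \<open>Chosen so that for \<open>N > 1\<close> the power
    \<open>real N powr \<eta> N\<close> is the square root of \<open>C * (1 + ln (real N))\<close>.
    At \<open>N = 1\<close> the denominator is 0 and the quotient is 0 by convention.\<close>
  define \<eta> where "\<eta> N = ln (C * (1 + ln (real N))) / (2 * ln (real N))" for N :: nat
  have "\<eta> \<longlonglongrightarrow> 0"
    unfolding \<eta>_def using C(1) by real_asymp
  moreover have "real (Q_sum (\<lambda>n. poly f (g ^ n)) M N S)
      \<le> real_of_int S powr (1 / 2) * real N powr (1 / (1 + \<alpha>) + \<eta> N)"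
    if N: "N \<ge> 1" and S: "S \<ge> 1" for M N S
  proof -
    let ?Q = "real (Q_sum (\<lambda>n. poly f (g ^ n)) M N S)"
    have le_N: "?Q \<le> real N" using Q_sum_le_interval_length by simp
    show ?thesis
    proof (cases "N = 1")
      case True
      have "1 \<le> real_of_int S powr (1 / 2)" using S by (intro ge_one_powr_ge_zero) auto
      then show ?thesis using le_N True by simp
    next
      case False
      define E where "E = C * (1 + ln (real N))"
      have lnN: "ln (real N) > 0" using N False by simp
      have E: "E > 0" using C(1) lnN by (simp add: E_def add_pos_pos)
      have "ln (real N) * \<eta> N = ln E / 2" using lnN by (simp add: \<eta>_def E_def)
      then have NE: "real N powr \<eta> N = E powr (1 / 2)" using N E by (simp add: powr_def mult.commute)
      \<comment> \<open>Geometric mean of the bound linear in \<open>S\<close> and the trivial bound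
        \<open>N\<close>.\<close>
      have "?Q * ?Q \<le> (real_of_int S * E) * real N"
        using C(2)[OF N S, of M] le_N by (intro mult_mono) (auto simp: E_def)
      then have "?Q \<le> ((real_of_int S * E) * real N) powr (1 / 2)"
        using S E by (subst powr_half_sqrt) (auto intro!: real_le_rsqrt simp: power2_eq_square)
      also have "\<dots> = real_of_int S powr (1 / 2) * (real N powr (1 / 2) * real N powr \<eta> N)"
        unfolding NE using S E N by (simp add: powr_mult)
      \<comment> \<open>Here \<open>\<alpha> < 1\<close> enters, through
        \<open>1 / 2 \<le> 1 / (1 + \<alpha>)\<close>.\<close>
      also have "\<dots> \<le> real_of_int S powr (1 / 2) * (real N powr (1 / (1 + \<alpha>)) * real N powr \<eta> N)"
        using \<alpha> assms(6) N by (intro mult_left_mono mult_right_mono powr_mono) (auto simp: field_simps)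
      finally show ?thesis by (simp add: powr_add)
    qed
  qed
  ultimately show ?thesis by blast
qed

end
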